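(* Let $\mathfrak g$ be a complex simple Lie algebra and let $V$ be a finite-dimensional irreducible $\mathfrak g$-module whose highest weight lies in the root lattice of $\mathfrak g$. Then $V\otimes\mathfrak g$ is generated, as a $\mathfrak g$-module, by its $\mathfrak g$-overshears.
   Context: $V\otimes\mathfrak g$ is a $\mathfrak g$-module via $(\rho\otimes\mathrm{ad})(\xi)(v\otimes\eta) = \rho(\xi)v\otimes\eta + v\otimes[\xi,\eta]$, where $\rho$ is the action on $V$. An element $v\otimes\xi$ ($v\in V$, $\xi\in\mathfrak g$) is a $\mathfrak g$-overshear if $\rho(\xi)^2v = 0$. *)

theory Defs
  imports Complex_Main "HOL-Library.Function_Algebras"
begin

text \<open>Complex vector spaces are represented by an additive group type together with an
explicit complex scalar multiplication (library locale vector_space).\<close>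

definition fin_dim :: "(complex \<Rightarrow> 'a::ab_group_add \<Rightarrow> 'a) \<Rightarrow> bool" where
  "fin_dim s \<longleftrightarrow> vector_space s \<and> (\<exists>B. finite B \<and> module.span s B = UNIV)"

definition lie_algebra :: "(complex \<Rightarrow> 'g::ab_group_add \<Rightarrow> 'g) \<Rightarrow> ('g \<Rightarrow> 'g \<Rightarrow> 'g) \<Rightarrow> bool" where
  "lie_algebra s br \<longleftrightarrow> vector_space s
     \<and> (\<forall>x. Vector_Spaces.linear s s (br x)) \<and> (\<forall>y. Vector_Spaces.linear s s (\<lambda>x. br x y))
     \<and> (\<forall>x. br x x = 0)
     \<and> (\<forall>x y z. br x (br y z) + br y (br z x) + br z (br x y) = 0)"

definition lie_ideal :: "(complex \<Rightarrow> 'g::ab_group_add \<Rightarrow> 'g) \<Rightarrow> ('g \<Rightarrow> 'g \<Rightarrow> 'g) \<Rightarrow> 'g set \<Rightarrow> bool" where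
  "lie_ideal s br I \<longleftrightarrow> module.subspace s I \<and> (\<forall>x. \<forall>y\<in>I. br x y \<in> I)"

definition simple_lie_algebra :: "(complex \<Rightarrow> 'g::ab_group_add \<Rightarrow> 'g) \<Rightarrow> ('g \<Rightarrow> 'g \<Rightarrow> 'g) \<Rightarrow> bool" where
  "simple_lie_algebra s br \<longleftrightarrow> lie_algebra s br \<and> (\<exists>x y. br x y \<noteq> 0)
     \<and> (\<forall>I. lie_ideal s br I \<longrightarrow> I = {0} \<or> I = UNIV)"

definition lie_module :: "(complex \<Rightarrow> 'g::ab_group_add \<Rightarrow> 'g) \<Rightarrow> ('g \<Rightarrow> 'g \<Rightarrow> 'g)
    \<Rightarrow> (complex \<Rightarrow> 'v::ab_group_add \<Rightarrow> 'v) \<Rightarrow> ('g \<Rightarrow> 'v \<Rightarrow> 'v) \<Rightarrow> bool" where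
  "lie_module sg br sv rho \<longleftrightarrow> vector_space sv
     \<and> (\<forall>x. Vector_Spaces.linear sv sv (rho x)) \<and> (\<forall>v. Vector_Spaces.linear sg sv (\<lambda>x. rho x v))
     \<and> (\<forall>x y v. rho (br x y) v = rho x (rho y v) - rho y (rho x v))"

definition invariant_subspace :: "(complex \<Rightarrow> 'v::ab_group_add \<Rightarrow> 'v) \<Rightarrow> ('g \<Rightarrow> 'v \<Rightarrow> 'v) \<Rightarrow> 'v set \<Rightarrow> bool" where
  "invariant_subspace sv rho U \<longleftrightarrow> module.subspace sv U \<and> (\<forall>x. \<forall>u\<in>U. rho x u \<in> U)"

definition irreducible_module :: "(complex \<Rightarrow> 'v::ab_group_add \<Rightarrow> 'v) \<Rightarrow> ('g \<Rightarrow> 'v \<Rightarrow> 'v) \<Rightarrow> bool" where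
  "irreducible_module sv rho \<longleftrightarrow> (UNIV :: 'v set) \<noteq> {0}
     \<and> (\<forall>U. invariant_subspace sv rho U \<longrightarrow> U = {0} \<or> U = UNIV)"

definition gen_submodule :: "(complex \<Rightarrow> 'w::ab_group_add \<Rightarrow> 'w) \<Rightarrow> ('g \<Rightarrow> 'w \<Rightarrow> 'w) \<Rightarrow> 'w set \<Rightarrow> 'w set" where
  "gen_submodule sw sigma S = \<Inter>{U. invariant_subspace sw sigma U \<and> S \<subseteq> U}"

text \<open>Cartan subalgebra of a (semisimple) complex Lie algebra: a maximal toral subalgebra,
 i.e. maximal among abelian subalgebras consisting of ad-semisimple elements.\<close>
definition ad_semisimple :: "(complex \<Rightarrow> 'g::ab_group_add \<Rightarrow> 'g) \<Rightarrow> ('g \<Rightarrow> 'g \<Rightarrow> 'g) \<Rightarrow> 'g \<Rightarrow> bool" where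
  "ad_semisimple s br x \<longleftrightarrow> module.span s {y. \<exists>c. br x y = s c y} = UNIV"

definition toral :: "(complex \<Rightarrow> 'g::ab_group_add \<Rightarrow> 'g) \<Rightarrow> ('g \<Rightarrow> 'g \<Rightarrow> 'g) \<Rightarrow> 'g set \<Rightarrow> bool" where
  "toral s br T \<longleftrightarrow> module.subspace s T \<and> (\<forall>x\<in>T. \<forall>y\<in>T. br x y = 0)
     \<and> (\<forall>x\<in>T. ad_semisimple s br x)"

definition cartan_subalgebra :: "(complex \<Rightarrow> 'g::ab_group_add \<Rightarrow> 'g) \<Rightarrow> ('g \<Rightarrow> 'g \<Rightarrow> 'g) \<Rightarrow> 'g set \<Rightarrow> bool" where
  "cartan_subalgebra s br H \<longleftrightarrow> toral s br H \<and> (\<forall>T. toral s br T \<and> H \<subseteq> T \<longrightarrow> T = H)"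

text \<open>Functionals on H are represented as functions 'g => complex vanishing outside H.\<close>
definition roots :: "(complex \<Rightarrow> 'g::ab_group_add \<Rightarrow> 'g) \<Rightarrow> ('g \<Rightarrow> 'g \<Rightarrow> 'g) \<Rightarrow> 'g set \<Rightarrow> ('g \<Rightarrow> complex) set" where
  "roots s br H = {\<alpha>. (\<forall>x. x \<notin> H \<longrightarrow> \<alpha> x = 0) \<and> (\<exists>h\<in>H. \<alpha> h \<noteq> 0)
     \<and> (\<exists>x. x \<noteq> 0 \<and> (\<forall>h\<in>H. br h x = s (\<alpha> h) x))}"

definition weights :: "'g set \<Rightarrow> (complex \<Rightarrow> 'v::ab_group_add \<Rightarrow> 'v) \<Rightarrow> ('g \<Rightarrow> 'v \<Rightarrow> 'v) \<Rightarrow> ('g \<Rightarrow> complex) set" where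
  "weights H sv rho = {\<mu>. (\<forall>x. x \<notin> H \<longrightarrow> \<mu> x = 0)
     \<and> (\<exists>v. v \<noteq> 0 \<and> (\<forall>h\<in>H. rho h v = sv (\<mu> h) v))}"

definition nat_comb :: "('g \<Rightarrow> complex) set \<Rightarrow> (('g \<Rightarrow> complex) \<Rightarrow> nat) \<Rightarrow> 'g \<Rightarrow> complex" where
  "nat_comb D c = (\<lambda>x. \<Sum>\<delta>\<in>D. of_nat (c \<delta>) * \<delta> x)"

definition root_base :: "(complex \<Rightarrow> 'g::ab_group_add \<Rightarrow> 'g) \<Rightarrow> ('g \<Rightarrow> 'g \<Rightarrow> 'g) \<Rightarrow> 'g set
    \<Rightarrow> ('g \<Rightarrow> complex) set \<Rightarrow> bool" where
  "root_base s br H \<Delta> \<longleftrightarrow> finite \<Delta> \<and> \<Delta> \<subseteq> roots s br H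
     \<and> \<not> module.dependent (\<lambda>(c::complex) (f::'g \<Rightarrow> complex) x. c * f x) \<Delta>
     \<and> (\<forall>\<alpha>\<in>roots s br H. \<exists>c. \<alpha> = nat_comb \<Delta> c \<or> \<alpha> = (\<lambda>x. - nat_comb \<Delta> c x))"

definition positive_roots :: "(complex \<Rightarrow> 'g::ab_group_add \<Rightarrow> 'g) \<Rightarrow> ('g \<Rightarrow> 'g \<Rightarrow> 'g) \<Rightarrow> 'g set
    \<Rightarrow> ('g \<Rightarrow> complex) set \<Rightarrow> ('g \<Rightarrow> complex) set" where
  "positive_roots s br H \<Delta> = {\<alpha>\<in>roots s br H. \<exists>c. \<alpha> = nat_comb \<Delta> c}"

definition highest_weight :: "(complex \<Rightarrow> 'g::ab_group_add \<Rightarrow> 'g) \<Rightarrow> ('g \<Rightarrow> 'g \<Rightarrow> 'g) \<Rightarrow> 'g set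
    \<Rightarrow> ('g \<Rightarrow> complex) set \<Rightarrow> (complex \<Rightarrow> 'v::ab_group_add \<Rightarrow> 'v) \<Rightarrow> ('g \<Rightarrow> 'v \<Rightarrow> 'v)
    \<Rightarrow> ('g \<Rightarrow> complex) \<Rightarrow> bool" where
  "highest_weight s br H \<Delta> sv rho \<mu> \<longleftrightarrow> \<mu> \<in> weights H sv rho
     \<and> (\<forall>\<alpha>\<in>positive_roots s br H \<Delta>. (\<lambda>x. \<mu> x + \<alpha> x) \<notin> weights H sv rho)"

definition root_lattice :: "(complex \<Rightarrow> 'g::ab_group_add \<Rightarrow> 'g) \<Rightarrow> ('g \<Rightarrow> 'g \<Rightarrow> 'g) \<Rightarrow> 'g set
    \<Rightarrow> ('g \<Rightarrow> complex) set" where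
  "root_lattice s br H = {\<mu>. \<exists>c :: ('g \<Rightarrow> complex) \<Rightarrow> int.
     \<mu> = (\<lambda>x. \<Sum>\<alpha>\<in>roots s br H. of_int (c \<alpha>) * \<alpha> x)}"

text \<open>Tensor product of finite-dimensional spaces V and W realised in a space T with the
 bilinear map tp: tp is bilinear, its image spans T, and dim T = dim V * dim W.\<close>
definition tensor_product :: "(complex \<Rightarrow> 'v::ab_group_add \<Rightarrow> 'v) \<Rightarrow> (complex \<Rightarrow> 'g::ab_group_add \<Rightarrow> 'g)
    \<Rightarrow> (complex \<Rightarrow> 't::ab_group_add \<Rightarrow> 't) \<Rightarrow> ('v \<Rightarrow> 'g \<Rightarrow> 't) \<Rightarrow> bool" where
  "tensor_product sv sg st tp \<longleftrightarrow> vector_space st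
     \<and> (\<forall>v. Vector_Spaces.linear sg st (tp v)) \<and> (\<forall>x. Vector_Spaces.linear sv st (\<lambda>v. tp v x))
     \<and> module.span st {tp v x | v x. True} = UNIV
     \<and> vector_space.dim st (UNIV :: 't set)
         = vector_space.dim sv (UNIV :: 'v set) * vector_space.dim sg (UNIV :: 'g set)"

end

theory Submission
  imports Defs "HOL-Computational_Algebra.Fundamental_Theorem_Algebra"
begin

text \<open>
  Let \<open>U\<close> be the submodule generated by the overshears. For an \<open>sl\<^sub>2\<close>-triple \<open>(e, f, h)\<close> and
  \<open>h v = 2 v\<close>, a computation in \<open>V \<otimes> sl\<^sub>2\<close> with the overshears \<open>u \<otimes> e\<close>, \<open>f u \<otimes> e\<close>
  (\<open>e u = 0\<close>) and \<open>w \<otimes> h\<close> (\<open>h w = 0\<close>) shows \<open>v \<otimes> f \<in> U\<close>. As every root vector lies in such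
  a triple and the centralizer of \<open>H\<close> is \<open>H\<close>, the zero weight space of \<open>V \<otimes> g\<close> lies in \<open>U\<close>.
  All weights of \<open>V \<otimes> g\<close> are sums of roots. If \<open>\<nu> = \<beta>\<^sub>1 + \<dots> + \<beta>\<^sub>r\<close> is nonzero, positivity of
  the Killing form on the real span of the roots makes \<open>\<nu>\<close> positive on some coroot of a \<open>\<beta>\<^sub>i\<close>;
  then lowering by \<open>\<beta>\<^sub>i\<close> is injective modulo \<open>U\<close> on the weight space of \<open>\<nu>\<close>, and induction on \<open>r\<close>
  puts every weight space into \<open>U\<close>.

  The Killing form is nondegenerate since otherwise it vanishes, and pairing \<open>ad x\<close> with the
  derivation acting by the conjugate eigenvalues of \<open>ad x\<close> shows that every \<open>ad x\<close> is
  nilpotent, contradicting Engel's theorem.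
\<close>

section \<open>Linear operators on finite-dimensional complex spaces\<close>

text \<open>At weight zero a root vector is always paired with a vector of the opposite weight,
  which has weight 2 for the triple in which that root vector plays the part of \<open>f\<close>;
  this is why weight 2 is the case to compute. Every other weight must be brought to zero by
  removing roots, and the root lattice hypothesis supplies these roots. Quotients and complete
  reducibility are avoided: statements modulo \<open>U\<close> are phrased as membership in
  \<open>U\<close> and rest on the nilpotency of raising operators.

  On the algebra side \<open>H\<close> is given as a maximal toral subalgebra, so identifying its
  centralizer with \<open>H\<close> requires the semisimple part of \<open>ad x\<close> to be some
  \<open>ad s\<close>. That follows once derivations are inner, hence from the nondegenerate Killing
  form, which must therefore come before any root theory. The conjugate-eigenvalue operator serves a
  second time to show that a root does not vanish on its coroot, in place of Lie's theorem.\<close>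

locale fd_complex_space = finite_dimensional_vector_space scale Basis
  for scale :: "complex \<Rightarrow> 'a::ab_group_add \<Rightarrow> 'a" (infixr \<open>*s\<close> 75) and Basis :: "'a set"
begin

abbreviation lin :: "('a \<Rightarrow> 'a) \<Rightarrow> bool" where
  "lin f \<equiv> Vector_Spaces.linear scale scale f"

lemma linI:
  assumes "\<And>x y. f (x + y) = f x + f y" "\<And>c x. f (c *s x) = c *s f x"
  shows "lin f"
  using assms vector_space_axioms by (simp add: Vector_Spaces.linear_iff)

lemma lin_add: "lin f \<Longrightarrow> f (x + y) = f x + f y"
  and lin_scale: "lin f \<Longrightarrow> f (c *s x) = c *s f x"
  by (simp_all add: Vector_Spaces.linear_iff)

lemma lin_zero [simp]: "lin f \<Longrightarrow> f 0 = 0"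
  using lin_scale[of f 0 0] by simp

lemma lin_diff: "lin f \<Longrightarrow> f (x - y) = f x - f y"
  by (metis add_diff_cancel_right' diff_add_cancel lin_add)

lemma lin_uminus: "lin f \<Longrightarrow> f (- x) = - f x"
  by (metis diff_0 lin_diff lin_zero)

lemma lin_sum: "lin f \<Longrightarrow> f (sum g S) = (\<Sum>a\<in>S. f (g a))"
  by (induction S rule: infinite_finite_induct) (simp_all add: lin_add)

lemma lin_comp: "lin f \<Longrightarrow> lin g \<Longrightarrow> lin (\<lambda>x. f (g x))"
  by (intro linI) (simp_all add: lin_add lin_scale)

lemma lin_plus: "lin f \<Longrightarrow> lin g \<Longrightarrow> lin (\<lambda>x. f x + g x)"
  by (intro linI) (simp_all add: lin_add lin_scale scale_right_distrib algebra_simps)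

lemma lin_minus: "lin f \<Longrightarrow> lin g \<Longrightarrow> lin (\<lambda>x. f x - g x)"
  by (intro linI) (simp_all add: lin_add lin_scale scale_right_diff_distrib algebra_simps)

lemma lin_smult: "lin f \<Longrightarrow> lin (\<lambda>x. c *s f x)"
  by (intro linI) (simp_all add: lin_add lin_scale scale_right_distrib mult.commute)

lemma lin_scale_self: "lin (\<lambda>x. c *s x)"
  by (intro linI) (simp_all add: scale_right_distrib mult.commute)

lemma lin_funpow: "lin f \<Longrightarrow> lin (f ^^ k)"
  by (induction k) (auto intro!: linI simp: lin_add lin_scale)

lemma lin_shift: "lin A \<Longrightarrow> lin (\<lambda>x. A x - c *s x)"
  by (intro lin_minus lin_scale_self)

lemma lin_eq_on_span:
  assumes "lin f" "lin g" "\<And>x. x \<in> S \<Longrightarrow> f x = g x" "x \<in> span S"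
  shows "f x = g x"
proof -
  have "subspace {x. f x = g x}"
    using assms(1,2) by (auto simp: subspace_def lin_add lin_scale)
  then have "span S \<subseteq> {x. f x = g x}"
    using assms(3) by (intro span_minimal) auto
  then show ?thesis using assms(4) by auto
qed

lemma basis_within:
  assumes "span S = UNIV"
  obtains B where "B \<subseteq> S" "independent B" "span B = UNIV" "finite B"
proof -
  obtain B where "B \<subseteq> S" "independent B" "S \<subseteq> span B"
    using maximal_independent_subset by blast
  moreover from this have "span S \<subseteq> span B" by (intro span_minimal) auto
  then have "span B = UNIV" using assms by auto
  ultimately show ?thesis using that finiteI_independent by blast
qed

subsection \<open>The trace\<close>

definition tr_on :: "'a set \<Rightarrow> ('a \<Rightarrow> 'a) \<Rightarrow> complex" where
  "tr_on B A = (\<Sum>b\<in>B. representation B (A b) b)"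

definition tr :: "('a \<Rightarrow> 'a) \<Rightarrow> complex" where
  "tr A = tr_on Basis A"

text \<open>With \<open>A\<close> the identity this is a change of coordinates, otherwise a matrix
  product; basis independence and cyclicity of the trace both reduce to it by exchanging two
  sums.\<close>

lemma representation_comp:
  assumes B: "independent B" "span B = UNIV" "finite B" and E: "independent E" "span E = UNIV"
    and A: "lin A"
  shows "representation E (A v) e = (\<Sum>b\<in>B. representation B v b * representation E (A b) e)"
proof -
  have v: "(\<Sum>b\<in>B. representation B v b *s b) = v"
    using B by (intro sum_representation_eq) auto
  have "A (\<Sum>b\<in>B. representation B v b *s b) = (\<Sum>b\<in>B. representation B v b *s A b)"
    by (simp add: lin_sum[OF A] lin_scale[OF A])
  then have "A v = (\<Sum>b\<in>B. representation B v b *s A b)" unfolding v .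
  then show ?thesis
    using E by (simp add: representation_sum representation_scale)
qed

lemma tr_on_basis_change:
  assumes B: "independent B" "span B = UNIV" and E: "independent E" "span E = UNIV" and A: "lin A"
  shows "tr_on B A = tr_on E A"
proof -
  have fin: "finite B" "finite E" using finiteI_independent B E by auto
  have id: "lin (\<lambda>x. x)" by (intro linI) auto
  have "tr_on B A = (\<Sum>b\<in>B. \<Sum>e\<in>E. representation E b e * representation B (A e) b)"
    unfolding tr_on_def by (intro sum.cong refl representation_comp[OF E fin(2) B A])
  also have "\<dots> = (\<Sum>e\<in>E. \<Sum>b\<in>B. representation B (A e) b * representation E b e)"
    by (subst sum.swap) (simp add: mult.commute)
  also have "\<dots> = tr_on E A"
    unfolding tr_on_def by (intro sum.cong refl representation_comp[OF B fin(1) E id, symmetric])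
  finally show ?thesis .
qed

lemma tr_eq_tr_on:
  assumes "independent B" "span B = UNIV" "lin A"
  shows "tr A = tr_on B A"
  unfolding tr_def by (rule tr_on_basis_change[OF independent_Basis span_Basis assms])

lemma tr_comm:
  assumes A: "lin A" and C: "lin C"
  shows "tr (\<lambda>x. A (C x)) = tr (\<lambda>x. C (A x))"
proof -
  note B = independent_Basis span_Basis finite_Basis
  have "tr (\<lambda>x. A (C x)) = (\<Sum>b\<in>Basis. \<Sum>d\<in>Basis.
      representation Basis (C b) d * representation Basis (A d) b)"
    unfolding tr_def tr_on_def by (intro sum.cong refl representation_comp[OF B B(1,2) A])
  also have "\<dots> = (\<Sum>d\<in>Basis. \<Sum>b\<in>Basis.
      representation Basis (A d) b * representation Basis (C b) d)"
    by (subst sum.swap) (simp add: mult.commute)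
  also have "\<dots> = tr (\<lambda>x. C (A x))"
    unfolding tr_def tr_on_def by (intro sum.cong refl representation_comp[OF B B(1,2) C, symmetric])
  finally show ?thesis .
qed

lemma tr_add: "tr (\<lambda>x. A x + C x) = tr A + tr C"
  by (simp add: tr_def tr_on_def representation_add independent_Basis span_Basis sum.distrib)

lemma tr_diff: "tr (\<lambda>x. A x - C x) = tr A - tr C"
  by (simp add: tr_def tr_on_def representation_diff independent_Basis span_Basis sum_subtractf)

lemma tr_smult: "tr (\<lambda>x. c *s A x) = c * tr A"
  by (simp add: tr_def tr_on_def representation_scale independent_Basis span_Basis sum_distrib_left)

lemma tr_zero [simp]: "tr (\<lambda>x. 0) = 0"
  using tr_smult[of 0 "\<lambda>x. 0"] by simp

lemma tr_on_eigenbasis: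
  assumes "independent B" "span B = UNIV" and "\<And>b. b \<in> B \<Longrightarrow> A b = c b *s b"
  shows "tr_on B A = (\<Sum>b\<in>B. c b)"
  unfolding tr_on_def using assms
  by (intro sum.cong) (auto simp: representation_scale representation_basis)

text \<open>The exponent may depend on \<open>v\<close>, so the property can be checked on a
  spanning set; \<open>loc_nilpotent_uniform\<close> recovers a common exponent.\<close>

definition loc_nilpotent :: "('a \<Rightarrow> 'a) \<Rightarrow> bool" where
  "loc_nilpotent A \<longleftrightarrow> (\<forall>v. \<exists>k. (A ^^ k) v = 0)"

lemma funpow_eq_0_mono:
  assumes "lin A" "(A ^^ k) v = 0" "k \<le> n"
  shows "(A ^^ n) v = 0"
proof -
  have "(A ^^ n) v = (A ^^ (n - k)) ((A ^^ k) v)"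
    using assms(3) by (metis add.commute comp_apply funpow_add le_add_diff_inverse)
  then show ?thesis using assms(1,2) lin_funpow by simp
qed

lemma subspace_loc_kernel:
  assumes "lin A"
  shows "subspace {v. \<exists>k. (A ^^ k) v = 0}"
proof (intro subspaceI; safe)
  show "\<exists>k. (A ^^ k) 0 = 0" by (intro exI[of _ 0]) simp
next
  fix x y k l assume "(A ^^ k) x = 0" "(A ^^ l) y = 0"
  then have "(A ^^ max k l) x = 0" "(A ^^ max k l) y = 0"
    using funpow_eq_0_mono[OF assms] by auto
  then show "\<exists>k. (A ^^ k) (x + y) = 0"
    using lin_add[OF lin_funpow[OF assms]] by (intro exI[of _ "max k l"]) simp
next
  fix c x k assume "(A ^^ k) x = 0"
  then show "\<exists>k. (A ^^ k) (c *s x) = 0"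
    using lin_scale[OF lin_funpow[OF assms]] by (intro exI[of _ k]) simp
qed

lemma loc_nilpotentI_span:
  assumes "lin A" "span S = UNIV" "\<And>v. v \<in> S \<Longrightarrow> \<exists>k. (A ^^ k) v = 0"
  shows "loc_nilpotent A"
proof -
  have "span S \<subseteq> {v. \<exists>k. (A ^^ k) v = 0}"
    using assms(3) by (intro span_minimal subspace_loc_kernel[OF assms(1)]) auto
  then show ?thesis using assms(2) unfolding loc_nilpotent_def by auto
qed

lemma loc_nilpotent_uniform:
  assumes "lin A" "loc_nilpotent A"
  obtains n where "\<And>v. (A ^^ n) v = 0"
proof -
  obtain k where k: "\<And>v. (A ^^ k v) v = 0"
    using assms(2) unfolding loc_nilpotent_def by metis
  define n where "n = Max (k ` Basis)"
  have "(A ^^ n) b = 0" if "b \<in> Basis" for b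
  proof (rule funpow_eq_0_mono[OF assms(1) k])
    show "k b \<le> n" unfolding n_def using that finite_Basis by (intro Max_ge) auto
  qed
  moreover have "lin (\<lambda>_. 0)" by (intro linI) simp_all
  ultimately have "(A ^^ n) v = (\<lambda>_. 0) v" for v
    using span_Basis lin_funpow[OF assms(1), of n]
      lin_eq_on_span[of "A ^^ n" "\<lambda>_. 0" Basis v] by simp
  then show ?thesis using that by blast
qed

text \<open>Bases of the ranges of \<open>A ^^ k\<close> are extended downwards in \<open>k\<close>; in the final basis no
  vector contributes to the diagonal.\<close>

lemma tr_nilpotent:
  assumes A: "lin A" "loc_nilpotent A"
  shows "tr A = 0"
proof -
  obtain n where n: "\<And>v. (A ^^ n) v = 0" using loc_nilpotent_uniform[OF A] by blast
  have "\<exists>B. independent B \<and> span B = range (A ^^ k) \<and> (\<forall>b\<in>B. A b \<in> span (B - {b}))"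
    if "k \<le> n" for k
    using that
  proof (induction k rule: inc_induct)
    case base
    have "range (A ^^ n) = {0}" using n by auto
    then show ?case by (intro exI[of _ "{}"]) (auto simp: independent_empty)
  next
    case (step k)
    then obtain S where S: "independent S" "span S = range (A ^^ Suc k)"
      "\<forall>b\<in>S. A b \<in> span (S - {b})" by auto
    have sub: "range (A ^^ Suc k) \<subseteq> range (A ^^ k)"
      unfolding funpow_Suc_right by auto
    have ss: "subspace (range (A ^^ k))"
    proof -
      interpret K: Vector_Spaces.linear scale scale "A ^^ k" by (rule lin_funpow[OF A(1)])
      show ?thesis using K.subspace_image[OF subspace_UNIV] .
    qed
    have "S \<subseteq> range (A ^^ k)" using S(2) sub span_superset by blast
    then obtain B where B: "S \<subseteq> B" "B \<subseteq> range (A ^^ k)" "independent B" "range (A ^^ k) \<subseteq> span B"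
      using maximal_independent_subset_extend S(1) by metis
    have "span B = range (A ^^ k)"
      using B span_minimal[OF B(2) ss] by auto
    moreover have "A b \<in> span (B - {b})" if b: "b \<in> B" for b
    proof (cases "b \<in> S")
      case True
      then show ?thesis using S(3) B(1) span_mono[of "S - {b}" "B - {b}"] by blast
    next
      case False
      \<comment> \<open>\<open>b\<close> is in the range of \<open>A ^^ k\<close>, so
        \<open>A b\<close> is in the range of \<open>A ^^ Suc k\<close>, which is spanned by
        \<open>S\<close>; and \<open>b\<close> is not in \<open>S\<close>.\<close>
      have "A b \<in> span S" using b B(2) S(2) by auto
      then show ?thesis using False B(1) span_mono[of S "B - {b}"] by blast
    qed
    ultimately show ?case using B(3) by blast
  qed
  from this[of 0] obtain B where B: "independent B" "span B = UNIV"
    "\<forall>b\<in>B. A b \<in> span (B - {b})" by auto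
  have "representation B (A b) b = 0" if "b \<in> B" for b
  proof -
    have i: "independent (B - {b})" using B(1) independent_mono by blast
    have "representation B (A b) = representation (B - {b}) (A b)"
      using B that by (intro representation_extend) auto
    then show ?thesis
      using representation_ne_zero[of "B - {b}" "A b" b] by auto
  qed
  then show ?thesis using tr_eq_tr_on[OF B(1,2) A(1)] unfolding tr_on_def by simp
qed

subsection \<open>Generalised eigenspaces\<close>

definition gen_eigenspace :: "('a \<Rightarrow> 'a) \<Rightarrow> complex \<Rightarrow> 'a set" where
  "gen_eigenspace A c = {v. \<exists>k. ((\<lambda>x. A x - c *s x) ^^ k) v = 0}"

lemma subspace_gen_eigenspace: "lin A \<Longrightarrow> subspace (gen_eigenspace A c)"
  unfolding gen_eigenspace_def by (intro subspace_loc_kernel lin_shift)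

lemma gen_eigenspace_eigen: "A v = c *s v \<Longrightarrow> v \<in> gen_eigenspace A c"
  unfolding gen_eigenspace_def by (intro CollectI exI[of _ 1]) simp

lemma shift_funpow_Suc:
  "((\<lambda>x. A x - c *s x) ^^ Suc k) v = ((\<lambda>x. A x - c *s x) ^^ k) (A v - c *s v)"
  by (simp add: funpow_Suc_right del: funpow.simps)

lemma gen_eigenspace_shift_iff:
  "A v - c *s v \<in> gen_eigenspace A c \<longleftrightarrow> v \<in> gen_eigenspace A c" if "lin A"
proof
  assume "A v - c *s v \<in> gen_eigenspace A c"
  then obtain k where "((\<lambda>x. A x - c *s x) ^^ k) (A v - c *s v) = 0"
    unfolding gen_eigenspace_def by auto
  then show "v \<in> gen_eigenspace A c"
    unfolding gen_eigenspace_def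
    by (intro CollectI exI[of _ "Suc k"]) (simp only: shift_funpow_Suc)
next
  assume "v \<in> gen_eigenspace A c"
  then obtain k where k: "((\<lambda>x. A x - c *s x) ^^ k) v = 0"
    unfolding gen_eigenspace_def by auto
  then have "((\<lambda>x. A x - c *s x) ^^ Suc k) v = 0"
    using funpow_eq_0_mono[OF lin_shift[OF that]] by (meson le_SucI order_refl)
  then show "A v - c *s v \<in> gen_eigenspace A c"
    unfolding gen_eigenspace_def
    by (intro CollectI exI[of _ k]) (simp only: shift_funpow_Suc)
qed

lemma funpow_commute:
  assumes "\<And>x. f (g x) = g (f x)"
  shows "(f ^^ k) (g x) = g ((f ^^ k) x)"
  by (induction k) (simp_all add: assms)

lemma gen_eigenspace_commute:
  assumes "lin C" and com: "\<And>x. C (A x) = A (C x)" and "v \<in> gen_eigenspace A c"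
  shows "C v \<in> gen_eigenspace A c"
proof -
  obtain k where k: "((\<lambda>x. A x - c *s x) ^^ k) v = 0"
    using assms(3) unfolding gen_eigenspace_def by auto
  have "((\<lambda>x. A x - c *s x) ^^ k) (C v) = C (((\<lambda>x. A x - c *s x) ^^ k) v)"
    by (intro funpow_commute) (simp add: com lin_diff lin_scale assms(1))
  then show ?thesis unfolding gen_eigenspace_def using k assms(1) by auto
qed

lemma gen_eigenspace_shift:
  assumes "lin A" "v \<in> gen_eigenspace A c"
  shows "((\<lambda>x. A x - d *s x) ^^ k) v \<in> gen_eigenspace A c"
  by (intro gen_eigenspace_commute[where C = "(\<lambda>x. A x - d *s x) ^^ k"] assms lin_funpow lin_shift)
     (simp add: funpow_commute lin_diff lin_scale assms(1))

text \<open>By induction on the exponent for \<open>c\<close>, the vector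
  \<open>A v - c *s v\<close> is zero, so \<open>v\<close> is a true eigenvector. On it
  \<open>A - d\<close> acts by the nonzero scalar \<open>c - d\<close>, and no power of that kills a
  nonzero vector.\<close>

lemma gen_eigenspace_Int:
  assumes A: "lin A" and "c \<noteq> d" "v \<in> gen_eigenspace A c" "v \<in> gen_eigenspace A d"
  shows "v = 0"
proof -
  obtain k where "((\<lambda>x. A x - c *s x) ^^ k) v = 0"
    using assms(3) unfolding gen_eigenspace_def by auto
  then show ?thesis using assms(4)
  proof (induction k arbitrary: v)
    case (Suc k)
    have "A v - c *s v \<in> gen_eigenspace A d"
      using gen_eigenspace_shift[OF A Suc.prems(2), where d = c and k = 1] by simp
    moreover have "((\<lambda>x. A x - c *s x) ^^ k) (A v - c *s v) = 0"
      using Suc.prems(1) by (simp only: shift_funpow_Suc)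
    ultimately have Av: "A v = c *s v" using Suc.IH[of "A v - c *s v"] by simp
    have "((\<lambda>x. A x - d *s x) ^^ j) v = (c - d)^j *s v" for j
    proof (induction j)
      case (Suc j)
      have "A v - d *s v = (c - d) *s v" using Av by (simp add: scale_left_diff_distrib)
      then have "(\<lambda>x. A x - d *s x) ((c - d)^j *s v) = (c - d)^j *s (c - d) *s v"
        using lin_scale[OF lin_shift[OF A, of d], of "(c - d)^j" v] by simp
      then show ?case using Suc by (simp add: mult.commute)
    qed simp
    moreover obtain j where "((\<lambda>x. A x - d *s x) ^^ j) v = 0"
      using Suc.prems(2) unfolding gen_eigenspace_def by blast
    ultimately show ?case using \<open>c \<noteq> d\<close> by simp
  qed simp
qed

text \<open>A power of \<open>A - d\<close> kills the \<open>d\<close>-summand and keeps the others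
  in their spaces. By induction it kills those too, so each of them also lies in the generalised
  eigenspace of \<open>d\<close> and vanishes.\<close>

lemma gen_eigenspace_indep:
  assumes A: "lin A" and "finite C" and "\<And>c. c \<in> C \<Longrightarrow> u c \<in> gen_eigenspace A c"
    and "(\<Sum>c\<in>C. u c) = 0" and "c \<in> C"
  shows "u c = 0"
proof -
  have "\<forall>c\<in>C. u c = 0"
    using assms(2-4)
  proof (induction C arbitrary: u rule: finite_induct)
    case (insert d C)
    obtain k where k: "((\<lambda>x. A x - d *s x) ^^ k) (u d) = 0"
      using insert.prems(1)[of d] unfolding gen_eigenspace_def by auto
    define M where "M = (\<lambda>x. A x - d *s x) ^^ k"
    have M: "lin M" unfolding M_def by (intro lin_funpow lin_shift A)
    have "(\<Sum>c\<in>C. M (u c)) = M (\<Sum>c\<in>insert d C. u c)"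
      using insert.hyps k[folded M_def] by (simp add: lin_sum[OF M] lin_add[OF M])
    then have sum0: "(\<Sum>c\<in>C. M (u c)) = 0" using insert.prems(2) M by simp
    have mem: "M (u c) \<in> gen_eigenspace A c" if "c \<in> C" for c
    proof -
      have "u c \<in> gen_eigenspace A c" using insert.prems(1) that by simp
      then show ?thesis unfolding M_def by (rule gen_eigenspace_shift[OF A])
    qed
    have M0: "\<forall>c\<in>C. M (u c) = 0" by (rule insert.IH[OF mem sum0])
    have "u c = 0" if c: "c \<in> C" for c
    proof (rule gen_eigenspace_Int[OF A])
      show "u c \<in> gen_eigenspace A c" using insert.prems(1) c by simp
      have "((\<lambda>x. A x - d *s x) ^^ k) (u c) = 0" using M0 c unfolding M_def by simp
      then show "u c \<in> gen_eigenspace A d" unfolding gen_eigenspace_def by blast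
      show "c \<noteq> d" using c insert.hyps by auto
    qed
    then show ?case using insert.prems(2) insert.hyps by simp
  qed simp
  then show ?thesis using assms(5) by blast
qed

text \<open>On this space \<open>A - d\<close> is the nonzero scalar \<open>c - d\<close> plus a
  nilpotent operator, hence invertible; the induction on the exponent carries out the geometric
  series.\<close>

lemma gen_eigenspace_surj:
  assumes A: "lin A" and "c \<noteq> d" "v \<in> gen_eigenspace A c"
  obtains u where "u \<in> gen_eigenspace A c" "A u - d *s u = v"
proof -
  have "\<exists>u\<in>gen_eigenspace A c. A u - d *s u = v"
  proof -
    obtain k where "((\<lambda>x. A x - c *s x) ^^ k) v = 0"
      using assms(3) unfolding gen_eigenspace_def by auto
    then show ?thesis using assms(3)
    proof (induction k arbitrary: v)
      case 0
      then show ?case using subspace_gen_eigenspace[OF A] subspace_0 A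
        by (intro bexI[of _ 0]) auto
    next
      case (Suc k)
      have "A v - c *s v \<in> gen_eigenspace A c"
        using gen_eigenspace_shift_iff[OF A] Suc.prems(2) by simp
      moreover have "((\<lambda>x. A x - c *s x) ^^ k) (A v - c *s v) = 0"
        using Suc.prems(1) by (simp only: shift_funpow_Suc)
      ultimately obtain u where u: "u \<in> gen_eigenspace A c" "A u - d *s u = A v - c *s v"
        using Suc.IH by blast
      \<comment> \<open>Subtracting \<open>A u - d *s u = A v - c *s v\<close> from
        \<open>A v - d *s v\<close> leaves \<open>(c - d) *s v\<close>.\<close>
      define w where "w = (1 / (c - d)) *s (v - u)"
      have "A w - d *s w = (1 / (c - d)) *s ((A v - d *s v) - (A u - d *s u))"
        unfolding w_def by (simp add: lin_scale[OF A] lin_diff[OF A] scale_right_diff_distrib mult.commute)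
      also have "\<dots> = (1 / (c - d)) *s ((c - d) *s v)"
        unfolding u(2) by (simp add: scale_left_diff_distrib)
      also have "\<dots> = v" using \<open>c \<noteq> d\<close> by simp
      finally show ?case
        using u Suc.prems(2) subspace_gen_eigenspace[OF A] unfolding w_def
        by (intro bexI[of _ w]) (auto simp: w_def intro!: subspace_scale subspace_diff)
    qed
  qed
  then show ?thesis using that by blast
qed

section \<open>Annihilating polynomials and the primary decomposition\<close>

definition poly_op :: "('a \<Rightarrow> 'a) \<Rightarrow> complex poly \<Rightarrow> 'a \<Rightarrow> 'a" where
  "poly_op A p v = (\<Sum>i\<le>degree p. coeff p i *s (A ^^ i) v)"

lemma poly_op_upto: "degree p \<le> n \<Longrightarrow> poly_op A p v = (\<Sum>i\<le>n. coeff p i *s (A ^^ i) v)"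
  unfolding poly_op_def by (intro sum.mono_neutral_left) (auto simp: coeff_eq_0)

lemma poly_op_linear_factor:
  assumes A: "lin A"
  shows "poly_op A ([:- c, 1:] * q) v = poly_op A q (A v - c *s v)"
proof -
  let ?n = "Suc (degree q)"
  have eq: "[:- c, 1:] * q = pCons 0 q - smult c q" by simp
  have "poly_op A ([:- c, 1:] * q) v
      = (\<Sum>i\<le>?n. coeff (pCons 0 q - smult c q) i *s (A ^^ i) v)"
    unfolding eq
    by (intro poly_op_upto degree_diff_le) (auto intro: order_trans[OF degree_smult_le])
  also have "\<dots> = (\<Sum>i\<le>?n. coeff (pCons 0 q) i *s (A ^^ i) v) - (\<Sum>i\<le>?n. (c * coeff q i) *s (A ^^ i) v)"
    by (simp add: scale_left_diff_distrib sum_subtractf)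
  also have "(\<Sum>i\<le>?n. coeff (pCons 0 q) i *s (A ^^ i) v) = (\<Sum>i\<le>degree q. coeff q i *s (A ^^ i) (A v))"
    by (subst sum.atMost_Suc_shift) (simp add: funpow_swap1)
  also have "(\<Sum>i\<le>?n. (c * coeff q i) *s (A ^^ i) v) = (\<Sum>i\<le>degree q. coeff q i *s (A ^^ i) (c *s v))"
    by (simp add: coeff_eq_0 lin_scale[OF lin_funpow[OF A]] mult.commute)
  finally show ?thesis
    unfolding poly_op_def
    by (simp add: lin_diff[OF lin_funpow[OF A]] scale_right_diff_distrib sum_subtractf)
qed

lemma poly_op_annihilates:
  assumes "lin A"
  obtains p where "p \<noteq> 0" "poly_op A p v = 0"
proof -
  define n where "n = card Basis"
  show ?thesis
  proof (cases "inj_on (\<lambda>i. (A ^^ i) v) {..n}")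
    \<comment> \<open>Two coinciding iterates are one element of the set \<open>S\<close> used
      below, so dependence of a set would miss them; a binomial annihilates \<open>v\<close>
      directly.\<close>
    case False
    then obtain i j where ij: "i \<noteq> j" "(A ^^ i) v = (A ^^ j) v" by (auto simp: inj_on_def)
    define p where "p = monom (1::complex) i - monom 1 j"
    have "coeff p i = 1" using ij by (simp add: p_def)
    then have "p \<noteq> 0" by auto
    moreover have "poly_op A p v = 0"
    proof -
      have "poly_op A p v = (\<Sum>k\<le>max i j. coeff p k *s (A ^^ k) v)"
        unfolding p_def by (intro poly_op_upto degree_diff_le) (auto simp: degree_monom_eq)
      also have "\<dots> = (\<Sum>k\<le>max i j. (if k = i then (A ^^ i) v else 0) - (if k = j then (A ^^ j) v else 0))"
        using ij(1) by (intro sum.cong refl) (simp add: p_def scale_left_diff_distrib)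
      also have "\<dots> = 0"
        using ij(2) by (simp add: sum_subtractf sum.delta)
      finally show ?thesis .
    qed
    ultimately show ?thesis using that by blast
  next
    case True
    define S where "S = (\<lambda>i. (A ^^ i) v) ` {..n}"
    have "card S = Suc n" unfolding S_def using True by (simp add: card_image)
    moreover have "dim S \<le> n" using dim_subset[of S UNIV] unfolding n_def by simp
    ultimately have "dependent S" by (intro dependent_biggerset_general) simp
    then obtain u w where u: "(\<Sum>s\<in>S. u s *s s) = 0" "w \<in> S" "u w \<noteq> 0"
      using dependent_finite[of S] unfolding S_def by auto
    define p where "p = (\<Sum>i\<le>n. monom (u ((A ^^ i) v)) i)"
    have c: "coeff p i = (if i \<le> n then u ((A ^^ i) v) else 0)" for i
      unfolding p_def by (simp add: coeff_sum if_distrib cong: if_cong)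
    obtain i where "i \<le> n" "w = (A ^^ i) v" using u(2) unfolding S_def by auto
    then have "coeff p i \<noteq> 0" using c u(3) by auto
    then have "p \<noteq> 0" by auto
    moreover have "poly_op A p v = (\<Sum>i\<le>n. coeff p i *s (A ^^ i) v)"
      by (intro poly_op_upto degree_le) (simp add: c)
    then have "poly_op A p v = 0"
      using u(1) True unfolding S_def by (simp add: c sum.reindex)
    ultimately show ?thesis using that by blast
  qed
qed

definition gen_eigen_sum :: "('a \<Rightarrow> 'a) \<Rightarrow> 'a set" where
  "gen_eigen_sum A = {v. \<exists>C u. finite C \<and> (\<forall>c\<in>C. u c \<in> gen_eigenspace A c) \<and> v = (\<Sum>c\<in>C. u c)}"

text \<open>Each component of the right-hand side with eigenvalue \<open>c\<close> other than
  \<open>d\<close> can be solved for within its own space. After subtracting these solutions,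
  \<open>A - d\<close> sends the remainder \<open>r\<close> into the generalised eigenspace of
  \<open>d\<close>, so \<open>r\<close> lies there itself.\<close>

lemma gen_eigen_sum_shiftD:
  assumes A: "lin A" and "A v - d *s v \<in> gen_eigen_sum A"
  shows "v \<in> gen_eigen_sum A"
proof -
  obtain C u where C: "finite C" "\<forall>c\<in>C. u c \<in> gen_eigenspace A c" "A v - d *s v = (\<Sum>c\<in>C. u c)"
    using assms(2) unfolding gen_eigen_sum_def by auto
  have "\<exists>w. w \<in> gen_eigenspace A c \<and> A w - d *s w = u c" if "c \<in> C - {d}" for c
  proof -
    have "c \<noteq> d" "u c \<in> gen_eigenspace A c" using C(2) that by auto
    then show ?thesis using gen_eigenspace_surj[OF A] by metis
  qed
  then have "\<forall>c. \<exists>w. c \<in> C - {d} \<longrightarrow> w \<in> gen_eigenspace A c \<and> A w - d *s w = u c" by blast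
  from choice[OF this] obtain w
    where w: "\<And>c. c \<in> C - {d} \<Longrightarrow> w c \<in> gen_eigenspace A c \<and> A (w c) - d *s w c = u c"
    by blast
  define r where "r = v - (\<Sum>c\<in>C - {d}. w c)"
  have "A r - d *s r = (A v - d *s v) - (\<Sum>c\<in>C - {d}. A (w c) - d *s w c)"
    unfolding r_def
    by (simp add: lin_diff[OF A] lin_sum[OF A] scale_right_diff_distrib scale_sum_right sum_subtractf)
  also have "(\<Sum>c\<in>C - {d}. A (w c) - d *s w c) = (\<Sum>c\<in>C - {d}. u c)"
    using w by (intro sum.cong refl) blast
  also have "A v - d *s v = (\<Sum>c\<in>C. u c)" by (rule C(3))
  finally have eq: "A r - d *s r = (\<Sum>c\<in>C. u c) - (\<Sum>c\<in>C - {d}. u c)" .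
  have "A r - d *s r \<in> gen_eigenspace A d"
  proof (cases "d \<in> C")
    case True
    then show ?thesis unfolding eq using C(1,2) by (simp add: sum_diff1)
  next
    case False
    then show ?thesis unfolding eq using subspace_0[OF subspace_gen_eigenspace[OF A]] by simp
  qed
  then have r: "r \<in> gen_eigenspace A d" using gen_eigenspace_shift_iff[OF A] by simp
  have "(\<Sum>c\<in>insert d C. (if c = d then r else w c)) = r + (\<Sum>c\<in>C - {d}. w c)"
    using C(1) by (subst sum.insert_remove) (auto intro!: sum.cong)
  moreover have "v = r + (\<Sum>c\<in>C - {d}. w c)" by (simp add: r_def)
  ultimately have "v = (\<Sum>c\<in>insert d C. (if c = d then r else w c))" by simp
  moreover have "\<forall>c\<in>insert d C. (if c = d then r else w c) \<in> gen_eigenspace A c"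
  proof
    fix c assume "c \<in> insert d C"
    then show "(if c = d then r else w c) \<in> gen_eigenspace A c" using r w[of c] by (cases "c = d") auto
  qed
  moreover have "finite (insert d C)" using C(1) by simp
  ultimately show ?thesis
    unfolding gen_eigen_sum_def
    by (intro CollectI exI[of _ "insert d C"] exI[of _ "\<lambda>c. if c = d then r else w c"] conjI)
qed

text \<open>Algebraic closedness enters here: a root \<open>c\<close> of a polynomial annihilating
  \<open>v\<close> can be split off, and the cofactor annihilates
  \<open>A v - c *s v\<close>.\<close>

lemma gen_eigen_sum_UNIV:
  assumes A: "lin A"
  shows "v \<in> gen_eigen_sum A"
proof -
  have "p \<noteq> 0 \<Longrightarrow> poly_op A p v = 0 \<Longrightarrow> v \<in> gen_eigen_sum A" for p v
  proof (induction "degree p" arbitrary: p v)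
    case 0
    obtain a where a: "p = [:a:]" using degree_eq_zeroE[OF 0(1)[symmetric]] .
    have "v = 0" using 0(2,3) unfolding a by (simp add: poly_op_def)
    then show ?case unfolding gen_eigen_sum_def by (intro CollectI exI[of _ "{}"]) auto
  next
    case (Suc n)
    have "\<not> constant (poly p)" using Suc(2) by (simp add: constant_degree)
    then obtain c where "poly p c = 0" using fundamental_theorem_of_algebra by blast
    then obtain q where q: "p = [:- c, 1:] * q" unfolding poly_eq_0_iff_dvd by (auto elim: dvdE)
    have "q \<noteq> 0" using q Suc.prems by auto
    then have "degree p = Suc (degree q)" unfolding q by (subst degree_mult_eq) auto
    moreover have "poly_op A q (A v - c *s v) = 0"
      using Suc.prems(2) unfolding q poly_op_linear_factor[OF A] .
    ultimately have "A v - c *s v \<in> gen_eigen_sum A"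
      using Suc.hyps \<open>q \<noteq> 0\<close> by simp
    then show ?case by (rule gen_eigen_sum_shiftD[OF A])
  qed
  then show ?thesis using poly_op_annihilates[OF A, of v] by blast
qed

definition spec :: "('a \<Rightarrow> 'a) \<Rightarrow> complex set" where
  "spec A = {c. gen_eigenspace A c \<noteq> {0}}"

lemma finite_spec:
  assumes A: "lin A"
  shows "finite (spec A)"
proof -
  have "\<exists>v. v \<in> gen_eigenspace A c \<and> v \<noteq> 0" if "c \<in> spec A" for c
    using that subspace_0[OF subspace_gen_eigenspace[OF A, of c]] unfolding spec_def by blast
  then obtain v where v: "\<And>c. c \<in> spec A \<Longrightarrow> v c \<in> gen_eigenspace A c \<and> v c \<noteq> 0" by metis
  have inj: "inj_on v (spec A)"
    by (intro inj_onI) (metis A gen_eigenspace_Int v)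
  have "independent (v ` spec A)"
  proof (unfold independent_explicit_finite_subsets, intro allI impI ballI)
    fix S u x
    assume S: "finite S" "S \<subseteq> v ` spec A" "(\<Sum>y\<in>S. u y *s y) = 0" "x \<in> S"
    then obtain C where C: "C \<subseteq> spec A" "S = v ` C" by (meson subset_image_iff)
    have injC: "inj_on v C" using inj C inj_on_subset by blast
    have "(\<Sum>c\<in>C. u (v c) *s v c) = 0"
      using S(3) unfolding C(2) by (simp add: sum.reindex[OF injC])
    moreover have "finite C" using S(1) C(2) injC finite_imageD by blast
    ultimately have "u (v c) *s v c = 0" if "c \<in> C" for c
      using gen_eigenspace_indep[OF A, of C "\<lambda>c. u (v c) *s v c" c] v C(1) that
        subspace_scale[OF subspace_gen_eigenspace[OF A]] by blast
    then show "u x = 0" using S(4) C v by force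
  qed
  then have "finite (v ` spec A)" by (rule finiteI_independent)
  then show ?thesis using inj finite_imageD by blast
qed

lemma gen_eigen_decomp:
  assumes A: "lin A"
  obtains u where "\<And>c. u c \<in> gen_eigenspace A c" "(\<Sum>c\<in>spec A. u c) = v"
proof -
  obtain C w where C: "finite C" "\<forall>c\<in>C. w c \<in> gen_eigenspace A c" "v = (\<Sum>c\<in>C. w c)"
    using gen_eigen_sum_UNIV[OF A, of v] unfolding gen_eigen_sum_def by auto
  define u where "u c = (if c \<in> C then w c else 0)" for c
  have u: "u c \<in> gen_eigenspace A c" for c
    using C(2) subspace_0[OF subspace_gen_eigenspace[OF A]] unfolding u_def by simp
  then have z: "u c = 0" if "c \<notin> spec A" for c
    using that unfolding spec_def by blast
  have "(\<Sum>c\<in>spec A. u c) = (\<Sum>c\<in>spec A \<union> C. u c)"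
    using z C(1) finite_spec[OF A] by (intro sum.mono_neutral_left) auto
  also have "\<dots> = (\<Sum>c\<in>C. u c)"
    using C(1) finite_spec[OF A] by (intro sum.mono_neutral_right) (auto simp: u_def)
  also have "\<dots> = v" unfolding C(3) by (intro sum.cong) (auto simp: u_def)
  finally show ?thesis using that u by blast
qed

lemma gen_eigen_decomp_unique:
  assumes A: "lin A" and "\<And>c. u c \<in> gen_eigenspace A c" "\<And>c. w c \<in> gen_eigenspace A c"
    and "(\<Sum>c\<in>spec A. u c) = (\<Sum>c\<in>spec A. w c)"
  shows "u c = w c"
proof (cases "c \<in> spec A")
  case True
  have "u c - w c = 0"
    by (rule gen_eigenspace_indep[OF A finite_spec[OF A], of "\<lambda>c. u c - w c"])
       (use assms True in \<open>auto simp: sum_subtractf intro!: subspace_diff[OF subspace_gen_eigenspace[OF A]]\<close>)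
  then show ?thesis by simp
next
  case False
  then have "gen_eigenspace A c = {0}" by (simp add: spec_def)
  then show ?thesis using assms(2,3)[of c] by simp
qed

section \<open>Functions of the semisimple part of an operator\<close>

definition eigen_comp :: "('a \<Rightarrow> 'a) \<Rightarrow> 'a \<Rightarrow> complex \<Rightarrow> 'a" where
  "eigen_comp A v = (SOME u. (\<forall>c. u c \<in> gen_eigenspace A c) \<and> (\<Sum>c\<in>spec A. u c) = v)"

lemma eigen_comp:
  assumes "lin A"
  shows "eigen_comp A v c \<in> gen_eigenspace A c" "(\<Sum>c\<in>spec A. eigen_comp A v c) = v"
proof -
  have "\<exists>u. (\<forall>c. u c \<in> gen_eigenspace A c) \<and> (\<Sum>c\<in>spec A. u c) = v"
    using gen_eigen_decomp[OF assms] by metis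
  from someI_ex[OF this] show "eigen_comp A v c \<in> gen_eigenspace A c"
    "(\<Sum>c\<in>spec A. eigen_comp A v c) = v" unfolding eigen_comp_def by auto
qed

lemma eigen_comp_eqI:
  assumes A: "lin A" and "\<And>c. u c \<in> gen_eigenspace A c" "(\<Sum>c\<in>spec A. u c) = v"
  shows "eigen_comp A v c = u c"
  by (rule gen_eigen_decomp_unique[OF A]) (simp_all add: eigen_comp[OF A] assms)

text \<open>This is \<open>f\<close> applied to the semisimple part of \<open>A\<close>. The
  identity gives that part itself, indicator functions give the projections to generalised
  eigenspaces, and \<open>cnj\<close> gives the operator with conjugate eigenvalues.\<close>

definition diag_op :: "(complex \<Rightarrow> complex) \<Rightarrow> ('a \<Rightarrow> 'a) \<Rightarrow> 'a \<Rightarrow> 'a" where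
  "diag_op f A v = (\<Sum>c\<in>spec A. f c *s eigen_comp A v c)"

lemma lin_diag_op:
  assumes A: "lin A"
  shows "lin (diag_op f A)"
proof (rule linI)
  fix x y
  have "eigen_comp A (x + y) c = eigen_comp A x c + eigen_comp A y c" for c
    by (rule eigen_comp_eqI[OF A])
       (simp_all add: eigen_comp[OF A] sum.distrib subspace_add[OF subspace_gen_eigenspace[OF A]])
  then show "diag_op f A (x + y) = diag_op f A x + diag_op f A y"
    unfolding diag_op_def by (simp add: scale_right_distrib sum.distrib)
next
  fix k x
  have "eigen_comp A (k *s x) c = k *s eigen_comp A x c" for c
    by (rule eigen_comp_eqI[OF A])
       (simp_all add: eigen_comp[OF A] scale_sum_right[symmetric] subspace_scale[OF subspace_gen_eigenspace[OF A]])
  then show "diag_op f A (k *s x) = k *s diag_op f A x"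
    unfolding diag_op_def by (simp add: scale_sum_right mult.commute)
qed

lemma eigen_comp_gen_eigenspace:
  assumes A: "lin A" and v: "v \<in> gen_eigenspace A c"
  shows "eigen_comp A v d = (if d = c then v else 0)"
proof (rule eigen_comp_eqI[OF A])
  show "(if d = c then v else 0) \<in> gen_eigenspace A d" for d
    using v subspace_0[OF subspace_gen_eigenspace[OF A]] by simp
  have "v = 0" if "c \<notin> spec A" using that v unfolding spec_def by blast
  then show "(\<Sum>d\<in>spec A. if d = c then v else 0) = v"
    using finite_spec[OF A] by simp
qed

lemma diag_op_gen_eigenspace:
  assumes A: "lin A" and v: "v \<in> gen_eigenspace A c"
  shows "diag_op f A v = f c *s v"
proof -
  have z: "v = 0" if "c \<notin> spec A" using that v unfolding spec_def by blast
  have "diag_op f A v = (\<Sum>d\<in>spec A. if d = c then f c *s v else 0)"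
    unfolding diag_op_def by (intro sum.cong) (simp_all add: eigen_comp_gen_eigenspace[OF A v])
  then show ?thesis using z finite_spec[OF A] by (cases "c \<in> spec A") simp_all
qed

lemma span_gen_eigenspaces:
  assumes A: "lin A"
  shows "span (\<Union>c. gen_eigenspace A c) = UNIV"
proof -
  have "v \<in> span (\<Union>c. gen_eigenspace A c)" for v
  proof -
    have "(\<Sum>c\<in>spec A. eigen_comp A v c) \<in> span (\<Union>c. gen_eigenspace A c)"
      using eigen_comp(1)[OF A] by (intro span_sum span_base) auto
    then show ?thesis by (simp add: eigen_comp(2)[OF A])
  qed
  then show ?thesis by auto
qed

lemma lin_eqI_gen_eigenspaces:
  assumes "lin A" "lin f" "lin g" "\<And>c v. v \<in> gen_eigenspace A c \<Longrightarrow> f v = g v"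
  shows "f v = g v"
  by (rule lin_eq_on_span[OF assms(2,3), of "\<Union>c. gen_eigenspace A c"])
     (use assms(4) span_gen_eigenspaces[OF assms(1)] in auto)

text \<open>An operator commuting with \<open>A\<close> preserves its generalised eigenspaces, on
  which \<open>diag_op f A\<close> is scalar. This takes the place of writing the semisimple part as
  a polynomial in \<open>A\<close>.\<close>

lemma diag_op_commute:
  assumes A: "lin A" and X: "lin X" and com: "\<And>x. X (A x) = A (X x)"
  shows "X (diag_op f A v) = diag_op f A (X v)"
proof (rule lin_eqI_gen_eigenspaces[OF A, where f = "\<lambda>v. X (diag_op f A v)" and g = "\<lambda>v. diag_op f A (X v)"])
  show "lin (\<lambda>v. X (diag_op f A v))" "lin (\<lambda>v. diag_op f A (X v))"
    by (rule lin_comp[OF X lin_diag_op[OF A]] lin_comp[OF lin_diag_op[OF A] X])+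
  fix c v assume v: "v \<in> gen_eigenspace A c"
  then have "X v \<in> gen_eigenspace A c" by (rule gen_eigenspace_commute[where C = X and A = A, OF X com])
  then show "X (diag_op f A v) = diag_op f A (X v)"
    by (simp add: diag_op_gen_eigenspace[OF A] diag_op_gen_eigenspace[OF A v] lin_scale[OF X])
qed

text \<open>The powers of \<open>N\<close> are multiples of those of \<open>A - c\<close>. Two cases
  are needed: \<open>A\<close> minus its semisimple part, with \<open>a = 1\<close>, and the same
  difference composed with \<open>diag_op cnj A\<close>, with \<open>a = cnj c\<close>.\<close>

lemma funpow_gen_eigenspace:
  assumes A: "lin A" and N: "lin N" and v: "v \<in> gen_eigenspace A c"
    and eq: "\<And>v. v \<in> gen_eigenspace A c \<Longrightarrow> N v = a *s (A v - c *s v)"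
  shows "\<exists>k. (N ^^ k) v = 0"
proof -
  have mem: "((\<lambda>x. A x - c *s x) ^^ k) v \<in> gen_eigenspace A c" for k
    by (rule gen_eigenspace_shift[OF A v])
  have "(N ^^ k) v = a ^ k *s ((\<lambda>x. A x - c *s x) ^^ k) v" for k
    by (induction k) (simp_all add: lin_scale[OF N] eq[OF mem] mult.commute)
  moreover obtain k where "((\<lambda>x. A x - c *s x) ^^ k) v = 0"
    using v unfolding gen_eigenspace_def by blast
  ultimately have "(N ^^ k) v = 0" by simp
  then show ?thesis ..
qed

abbreviation ss_part :: "('a \<Rightarrow> 'a) \<Rightarrow> 'a \<Rightarrow> 'a" where
  "ss_part A \<equiv> diag_op (\<lambda>c. c) A"

lemma loc_nilpotent_minus_ss_part:
  assumes A: "lin A"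
  shows "loc_nilpotent (\<lambda>x. A x - ss_part A x)"
proof (rule loc_nilpotentI_span[OF _ span_gen_eigenspaces[OF A]])
  show l: "lin (\<lambda>x. A x - ss_part A x)" by (intro lin_minus lin_diag_op A)
  fix v assume "v \<in> (\<Union>c. gen_eigenspace A c)"
  then obtain c where v: "v \<in> gen_eigenspace A c" by blast
  show "\<exists>k. ((\<lambda>x. A x - ss_part A x) ^^ k) v = 0"
    by (rule funpow_gen_eigenspace[OF A l v, of 1]) (simp add: diag_op_gen_eigenspace[OF A])
qed

text \<open>The trace below is the sum of the squared moduli of the eigenvalues of \<open>A\<close>. Conjugation is
  used instead of a polynomial in \<open>A\<close> because it is additive, so that \<open>diag_op cnj A\<close> is a
  derivation whenever \<open>A\<close> is one.\<close>

lemma loc_nilpotent_if_tr_cnj: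
  assumes A: "lin A" and t: "tr (\<lambda>x. A (diag_op cnj A x)) = 0"
  shows "loc_nilpotent A"
proof -
  let ?D = "diag_op cnj A" and ?S = "ss_part A"
  note D = lin_diag_op[OF A, of cnj] and S = lin_diag_op[OF A, of "\<lambda>c. c"]
  have l: "lin (\<lambda>x. A (?D x) - ?S (?D x))" by (rule lin_minus[OF lin_comp[OF A D] lin_comp[OF S D]])
  \<comment> \<open>Replacing \<open>A\<close> by its semisimple part changes the product with
    \<open>?D\<close> by a nilpotent operator and hence leaves the trace unchanged.\<close>
  have "loc_nilpotent (\<lambda>x. A (?D x) - ?S (?D x))"
  proof (rule loc_nilpotentI_span[OF l span_gen_eigenspaces[OF A]])
    fix v assume "v \<in> (\<Union>c. gen_eigenspace A c)"
    then obtain c where v: "v \<in> gen_eigenspace A c" by blast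
    show "\<exists>k. ((\<lambda>x. A (?D x) - ?S (?D x)) ^^ k) v = 0"
      by (rule funpow_gen_eigenspace[OF A l v, of "cnj c"])
         (simp add: diag_op_gen_eigenspace[OF A] lin_scale[OF A] lin_scale[OF S] scale_right_diff_distrib)
  qed
  then have "tr (\<lambda>x. A (?D x) - ?S (?D x)) = 0" by (rule tr_nilpotent[OF l])
  then have t0: "tr (\<lambda>x. ?S (?D x)) = 0" using t by (simp add: tr_diff)
  obtain B where B: "B \<subseteq> (\<Union>c. gen_eigenspace A c)" "independent B" "span B = UNIV" "finite B"
    using basis_within[OF span_gen_eigenspaces[OF A]] by blast
  then have "\<forall>b\<in>B. \<exists>c. b \<in> gen_eigenspace A c" by blast
  from bchoice[OF this] obtain e where e: "\<forall>b\<in>B. b \<in> gen_eigenspace A (e b)" by blast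
  have "tr (\<lambda>x. ?S (?D x)) = tr_on B (\<lambda>x. ?S (?D x))"
    by (rule tr_eq_tr_on[OF B(2,3) lin_comp[OF S D]])
  also have "\<dots> = (\<Sum>b\<in>B. cnj (e b) * e b)"
  proof (rule tr_on_eigenbasis[OF B(2,3)])
    fix b assume "b \<in> B"
    with e have b: "b \<in> gen_eigenspace A (e b)" by simp
    show "?S (?D b) = (cnj (e b) * e b) *s b"
      by (simp add: diag_op_gen_eigenspace[OF A b] lin_scale[OF S])
  qed
  also have "\<dots> = of_real (\<Sum>b\<in>B. (cmod (e b))\<^sup>2)"
    unfolding of_real_sum by (intro sum.cong refl) (metis complex_norm_square mult.commute)
  finally have "(\<Sum>b\<in>B. (cmod (e b))\<^sup>2) = 0" using t0 by (metis of_real_eq_0_iff)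
  then have "\<forall>b\<in>B. e b = 0" using B(4) by (simp add: sum_nonneg_eq_0_iff)
  then have "\<forall>b\<in>B. b \<in> gen_eigenspace A 0" using e by metis
  then have "\<And>b. b \<in> B \<Longrightarrow> \<exists>k. (A ^^ k) b = 0" unfolding gen_eigenspace_def by simp
  then show ?thesis by (rule loc_nilpotentI_span[OF A B(3)])
qed

section \<open>Diagonalizable, commuting and raising operators\<close>

definition diagonalizable :: "('a \<Rightarrow> 'a) \<Rightarrow> bool" where
  "diagonalizable A \<longleftrightarrow> span {v. \<exists>c. A v = c *s v} = UNIV"

lemma diagonalizable_ss_part:
  assumes A: "lin A" "diagonalizable A"
  shows "ss_part A v = A v"
proof (rule lin_eq_on_span[OF lin_diag_op[OF A(1)] A(1)])
  show "v \<in> span {v. \<exists>c. A v = c *s v}" using A(2) unfolding diagonalizable_def by simp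
  fix x assume "x \<in> {v. \<exists>c. A v = c *s v}"
  then obtain c where c: "A x = c *s x" by blast
  then have "x \<in> gen_eigenspace A c" by (rule gen_eigenspace_eigen)
  from diag_op_gen_eigenspace[OF A(1) this] show "ss_part A x = A x" unfolding c .
qed

lemma diagonalizable_gen_eigenspace:
  assumes "lin A" "diagonalizable A" "v \<in> gen_eigenspace A c"
  shows "A v = c *s v"
  using diagonalizable_ss_part[OF assms(1,2), of v] diag_op_gen_eigenspace[OF assms(1,3)] by simp

lemma diagonalizable_diag_op:
  assumes A: "lin A"
  shows "diagonalizable (diag_op f A)"
proof -
  have "(\<Union>c. gen_eigenspace A c) \<subseteq> {v. \<exists>c. diag_op f A v = c *s v}"
    using diag_op_gen_eigenspace[OF A] by blast
  from span_mono[OF this] show ?thesis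
    unfolding diagonalizable_def span_gen_eigenspaces[OF A] by auto
qed

lemma diagonalizable_nilpotent:
  assumes "lin A" "diagonalizable A" "loc_nilpotent A"
  shows "A v = 0"
proof -
  have "v \<in> gen_eigenspace A 0"
    using assms(3) unfolding gen_eigenspace_def loc_nilpotent_def by simp
  then show ?thesis using diagonalizable_gen_eigenspace[OF assms(1,2)] by fastforce
qed

text \<open>The projections to the eigenspaces of \<open>X\<close> commute with every operator
  commuting with \<open>X\<close>, so the \<open>X\<close>-components of a common eigenvector of
  \<open>F\<close> are common eigenvectors of \<open>insert X F\<close>.\<close>

lemma simultaneously_diagonalizable:
  assumes "finite F" "\<And>X. X \<in> F \<Longrightarrow> lin X" "\<And>X. X \<in> F \<Longrightarrow> diagonalizable X"
    and "\<And>X Y v. X \<in> F \<Longrightarrow> Y \<in> F \<Longrightarrow> X (Y v) = Y (X v)"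
  shows "span {v. \<forall>X\<in>F. \<exists>c. X v = c *s v} = UNIV"
  using assms
proof (induction F rule: finite_induct)
  case (insert X F)
  let ?S = "{v. \<forall>Y\<in>F. \<exists>c. Y v = c *s v}" and ?S' = "{v. \<forall>Y\<in>insert X F. \<exists>c. Y v = c *s v}"
  have IH: "span ?S = UNIV" using insert by simp
  have X: "lin X" "diagonalizable X" using insert.prems by auto
  have "?S \<subseteq> span ?S'"
  proof
    fix v assume v: "v \<in> ?S"
    have "eigen_comp X v c \<in> ?S'" for c
    proof -
      \<comment> \<open>The component map is rewritten as a \<open>diag_op\<close> so that
        \<open>diag_op_commute\<close> applies to it.\<close>
      let ?P = "diag_op (\<lambda>d. if d = c then 1 else 0) X"
      have P: "eigen_comp X v c = ?P v" if "c \<in> spec X"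
      proof -
        have "?P v = (\<Sum>d\<in>spec X. if d = c then eigen_comp X v c else 0)"
          unfolding diag_op_def by (intro sum.cong) auto
        then show ?thesis using finite_spec[OF X(1)] that by simp
      qed
      have P0: "eigen_comp X v c = 0" if "c \<notin> spec X"
        using eigen_comp(1)[OF X(1), of v c] that unfolding spec_def by blast
      have "\<exists>d. Y (eigen_comp X v c) = d *s eigen_comp X v c" if Y: "Y \<in> F" for Y
      proof (cases "c \<in> spec X")
        case True
        have lY: "lin Y" using insert.prems Y by simp
        obtain d where d: "Y v = d *s v" using v Y by blast
        have "Y (?P v) = ?P (Y v)"
          by (rule diag_op_commute[OF X(1) lY]) (use insert.prems(3) Y in simp)
        also have "\<dots> = d *s ?P v" unfolding d by (rule lin_scale[OF lin_diag_op[OF X(1)]])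
        finally show ?thesis unfolding P[OF True] by blast
      next
        case False
        then show ?thesis using insert.prems Y by (simp add: P0)
      qed
      moreover have "X (eigen_comp X v c) = c *s eigen_comp X v c"
        by (rule diagonalizable_gen_eigenspace[OF X eigen_comp(1)[OF X(1)]])
      ultimately show ?thesis by blast
    qed
    then have "(\<Sum>c\<in>spec X. eigen_comp X v c) \<in> span ?S'" by (intro span_sum span_base)
    then show "v \<in> span ?S'" by (simp only: eigen_comp(2)[OF X(1)])
  qed
  then have "span ?S \<subseteq> span ?S'" by (intro span_minimal) auto
  then show ?case unfolding IH by blast
qed simp

lemma loc_nilpotent_commuting_comp:
  assumes N: "lin N" "loc_nilpotent N" and X: "lin X" and com: "\<And>x. X (N x) = N (X x)"
  shows "loc_nilpotent (\<lambda>x. X (N x))"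
  unfolding loc_nilpotent_def
proof
  fix v
  have "((\<lambda>x. X (N x)) ^^ k) v = (X ^^ k) ((N ^^ k) v)" for k
  proof (induction k)
    case (Suc k)
    have "N ((X ^^ k) y) = (X ^^ k) (N y)" for y
      by (rule funpow_commute[symmetric]) (simp add: com)
    then show ?case using Suc by simp
  qed simp
  moreover obtain k where "(N ^^ k) v = 0" using N(2) unfolding loc_nilpotent_def by blast
  ultimately have "((\<lambda>x. X (N x)) ^^ k) v = 0" using lin_funpow[OF X] by simp
  then show "\<exists>k. ((\<lambda>x. X (N x)) ^^ k) v = 0" ..
qed

text \<open>In an eigenbasis the trace is a sum of squares of real numbers. Applied to
  \<open>br h\<close>, this makes the Killing form positive on elements with real
  eigenvalues.\<close>

lemma tr_square_real:
  assumes A: "lin A" and S: "span S = UNIV" and r: "\<And>v. v \<in> S \<Longrightarrow> \<exists>r::real. A v = of_real r *s v"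
  obtains q :: real where "q \<ge> 0" "tr (\<lambda>x. A (A x)) = of_real q" "q = 0 \<Longrightarrow> \<forall>v. A v = 0"
proof -
  obtain B where B: "B \<subseteq> S" "independent B" "span B = UNIV" "finite B"
    using basis_within[OF S] by blast
  then have "\<forall>b\<in>B. \<exists>r::real. A b = of_real r *s b" using r by blast
  from bchoice[OF this] obtain e :: "'a \<Rightarrow> real" where "\<forall>b\<in>B. A b = of_real (e b) *s b" ..
  then have e: "A b = of_real (e b) *s b" if "b \<in> B" for b using that by (rule bspec)
  have "tr (\<lambda>x. A (A x)) = tr_on B (\<lambda>x. A (A x))"
    by (rule tr_eq_tr_on[OF B(2,3) lin_comp[OF A A]])
  also have "\<dots> = (\<Sum>b\<in>B. of_real ((e b)\<^sup>2))"
    by (rule tr_on_eigenbasis[OF B(2,3)]) (simp add: e lin_scale[OF A] power2_eq_square)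
  also have "\<dots> = of_real (\<Sum>b\<in>B. (e b)\<^sup>2)" by simp
  finally have q: "tr (\<lambda>x. A (A x)) = of_real (\<Sum>b\<in>B. (e b)\<^sup>2)" .
  have "A v = 0" if "(\<Sum>b\<in>B. (e b)\<^sup>2) = 0" for v
  proof -
    have "\<forall>b\<in>B. e b = 0" using that B(4) by (simp add: sum_nonneg_eq_0_iff)
    then have z: "A b = 0" if "b \<in> B" for b using e[OF that] that by simp
    have "lin (\<lambda>_. 0)" by (intro linI) simp_all
    moreover have "v \<in> span B" using B(3) by simp
    ultimately show ?thesis using z by (intro lin_eq_on_span[OF A, of "\<lambda>_. 0" B v])
  qed
  then have "(\<Sum>b\<in>B. (e b)\<^sup>2) = 0 \<Longrightarrow> \<forall>v. A v = 0" by (intro allI)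
  moreover have "(\<Sum>b\<in>B. (e b)\<^sup>2) \<ge> 0" by (intro sum_nonneg) simp
  ultimately show ?thesis by (intro that[OF _ q])
qed

text \<open>\<open>X\<close> moves the generalised eigenspace of \<open>c\<close> to that of
  \<open>c + d\<close>, and \<open>c + k * d\<close> leaves the finite spectrum for some
  \<open>k\<close>. Generalised eigenspaces are used because \<open>A\<close> is not known to be
  diagonalizable.\<close>

lemma loc_nilpotent_raising:
  assumes A: "lin A" and X: "lin X" and com: "\<And>v. A (X v) = X (A v) + d *s X v" and d: "d \<noteq> 0"
  shows "loc_nilpotent X"
proof (rule loc_nilpotentI_span[OF X span_gen_eigenspaces[OF A]])
  fix v assume "v \<in> (\<Union>c. gen_eigenspace A c)"
  then obtain c where v: "v \<in> gen_eigenspace A c" by blast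
  have raise: "X w \<in> gen_eigenspace A (c + d)" if w: "w \<in> gen_eigenspace A c" for w c
  proof -
    obtain k where k: "((\<lambda>x. A x - c *s x) ^^ k) w = 0" using w unfolding gen_eigenspace_def by blast
    have "((\<lambda>x. A x - (c + d) *s x) ^^ j) (X w) = X (((\<lambda>x. A x - c *s x) ^^ j) w)" for j
      by (induction j) (simp_all add: com lin_diff[OF X] lin_scale[OF X] scale_left_distrib)
    then have "((\<lambda>x. A x - (c + d) *s x) ^^ k) (X w) = 0" using k X by simp
    then show ?thesis unfolding gen_eigenspace_def by blast
  qed
  have mem: "(X ^^ k) v \<in> gen_eigenspace A (c + of_nat k * d)" for k
  proof (induction k)
    case (Suc k)
    show ?case using raise[OF Suc] by (simp add: algebra_simps)
  qed (simp add: v)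
  have "inj (\<lambda>k::nat. c + of_nat k * d)" using d by (intro injI) simp
  then have "infinite (range (\<lambda>k::nat. c + of_nat k * d))" by (simp add: finite_image_iff)
  then have "\<not> range (\<lambda>k::nat. c + of_nat k * d) \<subseteq> spec A"
    using finite_spec[OF A] finite_subset by blast
  then obtain k :: nat where "c + of_nat k * d \<notin> spec A" by blast
  then have "(X ^^ k) v = 0" using mem[of k] unfolding spec_def by blast
  then show "\<exists>k. (X ^^ k) v = 0" ..
qed

end

section \<open>Lie algebras and the Killing form\<close>

locale fd_lie_algebra = fd_complex_space sg Bg
  for sg :: "complex \<Rightarrow> 'g::ab_group_add \<Rightarrow> 'g" (infixr \<open>*s\<close> 75) and Bg :: "'g set" +
  fixes br :: "'g \<Rightarrow> 'g \<Rightarrow> 'g"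
  assumes lie: "lie_algebra sg br"
begin

lemma lin_ad: "lin (br x)" and lin_br_left: "lin (\<lambda>x. br x y)"
  using lie unfolding lie_algebra_def by blast+

lemmas br_add_right = lin_add[OF lin_ad]
  and br_scale_right = lin_scale[OF lin_ad]
  and br_diff_right = lin_diff[OF lin_ad]
  and br_minus_right = lin_uminus[OF lin_ad]
  and br_add_left = lin_add[OF lin_br_left]
  and br_scale_left = lin_scale[OF lin_br_left]
  and br_diff_left = lin_diff[OF lin_br_left]
  and br_minus_left = lin_uminus[OF lin_br_left]

lemma br_zero_right [simp]: "br x 0 = 0" and br_zero_left [simp]: "br 0 x = 0"
  using lin_zero[OF lin_ad] lin_zero[OF lin_br_left] by auto

lemma br_self [simp]: "br x x = 0"
  using lie unfolding lie_algebra_def by blast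

lemma br_anticomm: "br x y = - br y x"
proof -
  have "br (x + y) (x + y) = 0" by (rule br_self)
  moreover have "br (x + y) (x + y) = br x y + br y x"
    unfolding br_add_right unfolding br_add_left by (simp add: add.commute)
  ultimately have "br x y + br y x = 0" by simp
  then show ?thesis by (rule eq_neg_iff_add_eq_0[THEN iffD2])
qed

lemma jacobi: "br x (br y z) = br (br x y) z + br y (br x z)"
proof -
  have "br x (br y z) + br y (br z x) + br z (br x y) = 0"
    using lie unfolding lie_algebra_def by blast
  moreover have "br y (br z x) = - br y (br x z)"
    by (subst br_anticomm[of z x]) (simp add: br_minus_right)
  moreover have "br z (br x y) = - br (br x y) z" by (rule br_anticomm)
  ultimately show ?thesis by (simp add: algebra_simps)
qed

lemma ad_br: "br (br x y) z = br x (br y z) - br y (br x z)"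
  by (simp add: jacobi[of x y z])

definition kappa :: "'g \<Rightarrow> 'g \<Rightarrow> complex" where
  "kappa x y = tr (\<lambda>z. br x (br y z))"

lemma kappa_comm: "kappa x y = kappa y x"
  unfolding kappa_def by (rule tr_comm[OF lin_ad lin_ad])

lemma kappa_add_left: "kappa (x + y) z = kappa x z + kappa y z"
  unfolding kappa_def br_add_left by (rule tr_add)

lemma kappa_scale_left: "kappa (c *s x) z = c * kappa x z"
  unfolding kappa_def br_scale_left by (rule tr_smult)

lemma kappa_add_right: "kappa x (y + z) = kappa x y + kappa x z"
  by (simp add: kappa_comm[of x] kappa_add_left)

lemma kappa_scale_right: "kappa x (c *s z) = c * kappa x z"
  by (simp add: kappa_comm[of x] kappa_scale_left)

lemma kappa_zero_left [simp]: "kappa 0 x = 0" and kappa_zero_right [simp]: "kappa x 0 = 0"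
  using kappa_scale_left[of 0 0 x] kappa_scale_right[of x 0 0] by auto

lemma kappa_diff_left: "kappa (x - y) z = kappa x z - kappa y z"
  using kappa_add_left[of "x - y" y z] by simp

lemma kappa_diff_right: "kappa x (y - z) = kappa x y - kappa x z"
  by (simp add: kappa_comm[of x] kappa_diff_left)

lemma kappa_sum_left: "kappa (\<Sum>i\<in>I. f i) z = (\<Sum>i\<in>I. kappa (f i) z)"
  by (induction I rule: infinite_finite_induct) (simp_all add: kappa_add_left)

lemma subspace_kappa_zero: "subspace {y. kappa x y = 0}"
  by (simp add: subspace_def kappa_add_right kappa_scale_right)

lemma kappa_zero_span:
  assumes "span S = UNIV" "\<And>y. y \<in> S \<Longrightarrow> kappa x y = 0"
  shows "kappa x y = 0"
proof -
  have "span S \<subseteq> {y. kappa x y = 0}"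
    using assms(2) by (intro span_minimal subspace_kappa_zero) auto
  then show ?thesis using assms(1) by auto
qed

lemma lin_ad2: "lin (\<lambda>z. br x (br y z))"
  by (rule lin_comp[OF lin_ad lin_ad])

lemma kappa_invariant: "kappa (br x y) z = kappa x (br y z)"
proof -
  have "kappa (br x y) z = tr (\<lambda>w. br x (br y (br z w))) - tr (\<lambda>w. br y (br x (br z w)))"
    unfolding kappa_def ad_br by (rule tr_diff)
  also have "tr (\<lambda>w. br y (br x (br z w))) = tr (\<lambda>w. br x (br z (br y w)))"
    by (rule tr_comm[OF lin_ad lin_ad2])
  also have "tr (\<lambda>w. br x (br y (br z w))) - \<dots> = kappa x (br y z)"
    unfolding kappa_def ad_br br_diff_right by (rule tr_diff[symmetric])
  finally show ?thesis .
qed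

text \<open>By the Jacobi identity, \<open>ad x - (a + b)\<close> applied to \<open>br u v\<close>
  is the sum of two brackets, in which \<open>ad x - a\<close> acts on \<open>u\<close> or
  \<open>ad x - b\<close> acts on \<open>v\<close>. Each term lowers one of the two exponents, hence
  the induction on \<open>k + l\<close>.\<close>

lemma gen_eigenspace_br:
  assumes u: "u \<in> gen_eigenspace (br x) a" and v: "v \<in> gen_eigenspace (br x) b"
  shows "br u v \<in> gen_eigenspace (br x) (a + b)"
proof -
  obtain k where k: "((\<lambda>y. br x y - a *s y) ^^ k) u = 0"
    using u unfolding gen_eigenspace_def by blast
  obtain l where l: "((\<lambda>y. br x y - b *s y) ^^ l) v = 0"
    using v unfolding gen_eigenspace_def by blast
  have z: "0 \<in> gen_eigenspace (br x) (a + b)"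
    by (rule subspace_0[OF subspace_gen_eigenspace[OF lin_ad]])
  have "((\<lambda>y. br x y - a *s y) ^^ k) u = 0 \<Longrightarrow> ((\<lambda>y. br x y - b *s y) ^^ l) v = 0
      \<Longrightarrow> br u v \<in> gen_eigenspace (br x) (a + b)" for k l u v
  proof (induction "k + l" arbitrary: k l u v)
    case 0
    then show ?case using z by simp
  next
    case (Suc n)
    show ?case
    proof (cases "k = 0 \<or> l = 0")
      case True
      then show ?thesis using Suc.prems z by (elim disjE) simp_all
    next
      case False
      then obtain k' l' where kl: "k = Suc k'" "l = Suc l'" by (metis not0_implies_Suc)
      have "br (br x u - a *s u) v \<in> gen_eigenspace (br x) (a + b)"
        using Suc.hyps(2) kl Suc.prems(1)[unfolded kl shift_funpow_Suc] Suc.prems(2)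
        by (intro Suc.hyps(1)[of k' l]) simp_all
      moreover have "br u (br x v - b *s v) \<in> gen_eigenspace (br x) (a + b)"
        using Suc.hyps(2) kl Suc.prems(1) Suc.prems(2)[unfolded kl shift_funpow_Suc]
        by (intro Suc.hyps(1)[of k l']) simp_all
      ultimately have "br (br x u - a *s u) v + br u (br x v - b *s v) \<in> gen_eigenspace (br x) (a + b)"
        by (rule subspace_add[OF subspace_gen_eigenspace[OF lin_ad]])
      also have "br (br x u - a *s u) v + br u (br x v - b *s v) = br x (br u v) - (a + b) *s br u v"
        by (simp add: jacobi[of x u v] br_diff_left br_diff_right br_scale_left br_scale_right
            scale_left_distrib)
      finally show ?thesis using gen_eigenspace_shift_iff[OF lin_ad] by simp
    qed
  qed
  from this[OF k l] show ?thesis .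
qed

section \<open>Derivations and Engel's theorem\<close>

definition derivation :: "('g \<Rightarrow> 'g) \<Rightarrow> bool" where
  "derivation D \<longleftrightarrow> lin D \<and> (\<forall>x y. D (br x y) = br (D x) y + br x (D y))"

text \<open>The generalised eigenspaces of \<open>ad x\<close> grade the algebra by the complex
  numbers, and an additive function of the degree is a derivation. Both the identity and
  \<open>cnj\<close> are additive.\<close>

lemma derivation_diag_op:
  assumes f: "\<And>a b. f (a + b) = f a + f b"
  shows "derivation (diag_op f (br x))"
proof -
  let ?D = "diag_op f (br x)"
  have D: "lin ?D" by (rule lin_diag_op[OF lin_ad])
  have 1: "?D (br u v) = br (?D u) v + br u (?D v)" if u: "u \<in> gen_eigenspace (br x) a" for u v a
  proof (rule lin_eqI_gen_eigenspaces[OF lin_ad, where f = "\<lambda>v. ?D (br u v)"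
        and g = "\<lambda>v. br (?D u) v + br u (?D v)"])
    show "lin (\<lambda>v. ?D (br u v))" by (rule lin_comp[OF D lin_ad])
    show "lin (\<lambda>v. br (?D u) v + br u (?D v))"
      by (rule lin_plus[OF lin_ad lin_comp[OF lin_ad D]])
    fix b v assume v: "v \<in> gen_eigenspace (br x) b"
    show "?D (br u v) = br (?D u) v + br u (?D v)"
      by (simp add: diag_op_gen_eigenspace[OF lin_ad u] diag_op_gen_eigenspace[OF lin_ad v]
          diag_op_gen_eigenspace[OF lin_ad gen_eigenspace_br[OF u v]] f scale_left_distrib
          br_scale_left br_scale_right)
  qed
  have "?D (br u v) = br (?D u) v + br u (?D v)" for u v
  proof (rule lin_eqI_gen_eigenspaces[OF lin_ad, where f = "\<lambda>u. ?D (br u v)"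
        and g = "\<lambda>u. br (?D u) v + br u (?D v)"])
    show "lin (\<lambda>u. ?D (br u v))" by (rule lin_comp[OF D lin_br_left])
    show "lin (\<lambda>u. br (?D u) v + br u (?D v))"
      by (rule lin_plus[OF lin_comp[OF lin_br_left D] lin_br_left])
  qed (rule 1)
  then show ?thesis unfolding derivation_def using D by blast
qed

text \<open>Engel's theorem for the action on \<open>W / W'\<close>; stating it relatively avoids quotients in the
  induction, where \<open>N\<close> acts on \<open>M / N\<close>.\<close>

lemma engel:
  assumes "subspace M" "\<And>x y. x \<in> M \<Longrightarrow> y \<in> M \<Longrightarrow> br x y \<in> M" "\<And>x. x \<in> M \<Longrightarrow> loc_nilpotent (br x)"
    and "subspace W" "subspace W'" "W' \<subset> W"
    and "\<And>x w. x \<in> M \<Longrightarrow> w \<in> W \<Longrightarrow> br x w \<in> W" "\<And>x w. x \<in> M \<Longrightarrow> w \<in> W' \<Longrightarrow> br x w \<in> W'"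
  shows "\<exists>w\<in>W - W'. \<forall>x\<in>M. br x w \<in> W'"
  using assms
proof (induction "dim M" arbitrary: M W W' rule: less_induct)
  case less
  show ?case
  proof (cases "M = {0}")
    case True
    obtain w where "w \<in> W - W'" using less.prems(6) by blast
    then show ?thesis using True subspace_0[OF less.prems(5)] by auto
  next
    case False
    define Q where "Q N \<longleftrightarrow> subspace N \<and> N \<subset> M \<and> (\<forall>x\<in>N. \<forall>y\<in>N. br x y \<in> N)" for N
    have Q0: "Q {0}" unfolding Q_def using False subspace_0[OF less.prems(1)] by auto
    have bound: "\<forall>N. Q N \<longrightarrow> dim N < Suc (dim M)" unfolding Q_def
      by (auto simp: less_Suc_eq_le intro!: dim_subset)
    from ex_has_greatest_nat[of Q, OF Q0 bound]
    obtain N where QN: "Q N" and max: "\<And>N'. Q N' \<Longrightarrow> dim N' \<le> dim N" by blast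
    have N: "subspace N" "N \<subset> M" "\<And>x y. x \<in> N \<Longrightarrow> y \<in> N \<Longrightarrow> br x y \<in> N"
      using QN unfolding Q_def by blast+
    have NM: "x \<in> M" if "x \<in> N" for x using that N(2) by blast
    have span: "span N = N" "span M = M" using N(1) less.prems(1) by simp_all
    have dN: "dim N < dim M" by (rule dim_psubset) (simp only: span N(2))
    \<comment> \<open>The induction hypothesis is used twice for the maximal proper subalgebra
      \<open>N\<close>: on \<open>M / N\<close> it gives an element normalising \<open>N\<close>,
      and on \<open>W / W'\<close> a vector killed by \<open>N\<close>.\<close>
    have "\<exists>x\<in>M - N. \<forall>n\<in>N. br n x \<in> N"
      by (rule less.hyps[OF dN]) (use N NM less.prems(1,2,3) in auto)
    then obtain x where x: "x \<in> M" "x \<notin> N" "\<And>n. n \<in> N \<Longrightarrow> br n x \<in> N" by blast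
    have "\<exists>w\<in>W - W'. \<forall>n\<in>N. br n w \<in> W'"
      by (rule less.hyps[OF dN]) (use N NM less.prems in auto)
    then obtain w0 where w0: "w0 \<in> W" "w0 \<notin> W'" "\<And>n. n \<in> N \<Longrightarrow> br n w0 \<in> W'" by blast
    let ?N2 = "span (insert x N)"
    have dec: "\<exists>c. m - c *s x \<in> N" if "m \<in> ?N2" for m
      using that unfolding span_breakdown_eq span(1) .
    have N2M: "?N2 \<subseteq> M" using x(1) NM by (intro span_minimal less.prems(1)) auto
    have xN: "br x n \<in> N" if "n \<in> N" for n
      using x(3)[OF that] br_anticomm[of x n] subspace_neg[OF N(1)] by simp
    have "M = ?N2"
    proof (rule ccontr)
      assume "M \<noteq> ?N2"
      have "br m m' \<in> ?N2" if m: "m \<in> ?N2" "m' \<in> ?N2" for m m'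
      proof -
        obtain c where c: "m - c *s x \<in> N" using dec[OF m(1)] by blast
        obtain c' where c': "m' - c' *s x \<in> N" using dec[OF m(2)] by blast
        have "br m m' = br ((m - c *s x) + c *s x) ((m' - c' *s x) + c' *s x)" by simp
        also have "\<dots> = br (m - c *s x) (m' - c' *s x) + c' *s br (m - c *s x) x + c *s br x (m' - c' *s x)"
          by (simp only: br_add_left br_add_right br_scale_left br_scale_right br_self
              scale_zero_right add_0_right) (simp add: algebra_simps)
        also have "\<dots> \<in> N"
          by (intro subspace_add[OF N(1)] subspace_scale[OF N(1)] N(3) x(3) xN c c')
        finally show ?thesis using span_base[of _ "insert x N"] by blast
      qed
      then have "Q ?N2" unfolding Q_def using N2M \<open>M \<noteq> ?N2\<close> by blast
      then have "dim ?N2 \<le> dim N" by (rule max)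
      moreover have "dim ?N2 = dim N + 1" using x(2) by (simp only: dim_span dim_insert span(1) if_False)
      ultimately show False by simp
    qed
    \<comment> \<open>Since \<open>x\<close> normalises \<open>N\<close>, all iterates
      \<open>w k\<close> are killed by \<open>N\<close> modulo \<open>W'\<close>. The last iterate
      outside \<open>W'\<close> is killed by \<open>x\<close> as well, hence by all of
      \<open>M\<close>.\<close>
    define w where "w k = (br x ^^ k) w0" for k
    obtain K where "w K = 0" using less.prems(3)[OF x(1)] unfolding loc_nilpotent_def w_def by blast
    then have ex: "\<exists>k. w k \<in> W'" using subspace_0[OF less.prems(5)] by (intro exI[of _ K]) simp
    define k where "k = (LEAST k. w k \<in> W')"
    have k: "w k \<in> W'" unfolding k_def by (rule LeastI_ex[OF ex])
    have "w 0 \<notin> W'" using w0(2) by (simp add: w_def)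
    then obtain j where j: "k = Suc j" using k by (cases k) auto
    have wj: "w j \<notin> W'" using not_less_Least[of j "\<lambda>k. w k \<in> W'"] j unfolding k_def by simp
    have wW: "w i \<in> W \<and> (\<forall>n\<in>N. br n (w i) \<in> W')" for i
    proof (induction i)
      case (Suc i)
      have "br n (br x (w i)) \<in> W'" if "n \<in> N" for n
        unfolding jacobi[of n x]
        using Suc x(3)[OF that] less.prems(8)[OF x(1)] that by (intro subspace_add[OF less.prems(5)]) auto
      then show ?case using Suc less.prems(7)[OF x(1)] by (simp add: w_def)
    qed (use w0 in \<open>simp add: w_def\<close>)
    have "br m (w j) \<in> W'" if m: "m \<in> M" for m
    proof -
      obtain c where c: "m - c *s x \<in> N" using dec m \<open>M = ?N2\<close> by blast
      have "br m (w j) = br (m - c *s x) (w j) + c *s br x (w j)"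
        by (simp add: br_diff_left br_scale_left)
      moreover have "br x (w j) \<in> W'" using k unfolding j w_def by simp
      ultimately show ?thesis
        using wW[of j] c subspace_add[OF less.prems(5)] subspace_scale[OF less.prems(5)] by metis
    qed
    then show ?thesis using wW[of j] wj by blast
  qed
qed

end

subsection \<open>Nondegeneracy of the Killing form\<close>

locale simple_fd_lie = fd_lie_algebra +
  assumes simple: "simple_lie_algebra sg br"
begin

lemma ideal_cases: "lie_ideal sg br I \<Longrightarrow> I = {0} \<or> I = UNIV"
  and nonabelian: "\<exists>x y. br x y \<noteq> 0"
  using simple unfolding simple_lie_algebra_def by blast+

lemma center_zero:
  assumes "\<And>y. br x y = 0"
  shows "x = 0"
proof -
  let ?Z = "{x. \<forall>y. br x y = 0}"
  have "br z x = 0" if "\<forall>y. br x y = 0" for x z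
    using that by (subst br_anticomm) simp
  then have "lie_ideal sg br ?Z"
    unfolding lie_ideal_def by (auto simp: subspace_def br_add_left br_scale_left)
  then have "?Z = {0} \<or> ?Z = UNIV" by (rule ideal_cases)
  moreover have "?Z \<noteq> UNIV" using nonabelian by blast
  ultimately show ?thesis using assms by blast
qed

lemma span_brackets: "span {br x y |x y. True} = UNIV"
proof -
  have "lie_ideal sg br (span {br x y |x y. True})"
    unfolding lie_ideal_def by (auto intro: span_base)
  then have "span {br x y |x y. True} = {0} \<or> span {br x y |x y. True} = UNIV" by (rule ideal_cases)
  moreover obtain x y where "br x y \<noteq> 0" using nonabelian by blast
  moreover have "br x y \<in> span {br x y |x y. True}" by (intro span_base) blast
  ultimately show ?thesis by blast
qed

lemma kappa_not_zero: "\<exists>x y. kappa x y \<noteq> 0"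
proof (rule ccontr)
  assume "\<not> ?thesis"
  then have k0: "kappa x y = 0" for x y by blast
  have nil: "loc_nilpotent (br x)" for x
  proof (rule loc_nilpotent_if_tr_cnj[OF lin_ad])
    let ?D = "diag_op cnj (br x)"
    have der: "derivation ?D" by (rule derivation_diag_op) simp
    then have D: "lin ?D" and dD: "\<And>a b. ?D (br a b) = br (?D a) b + br a (?D b)"
      unfolding derivation_def by blast+
    \<comment> \<open>For a derivation the commutator with \<open>ad b\<close> is
      \<open>ad (?D b)\<close>, so cyclicity turns this trace into \<open>- kappa a (?D b)\<close>.
      Brackets span the algebra, which extends the vanishing to every \<open>x\<close>.\<close>
    have 0: "tr (\<lambda>v. br (br a b) (?D v)) = 0" for a b
    proof -
      have "tr (\<lambda>v. br (br a b) (?D v)) = tr (\<lambda>v. br a (br b (?D v))) - tr (\<lambda>v. br b (br a (?D v)))"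
        unfolding ad_br by (rule tr_diff)
      also have "tr (\<lambda>v. br b (br a (?D v))) = tr (\<lambda>v. br a (?D (br b v)))"
        by (rule tr_comm[OF lin_ad lin_comp[OF lin_ad D]])
      also have "tr (\<lambda>v. br a (br b (?D v))) - \<dots> = tr (\<lambda>v. br a (br b (?D v)) - br a (?D (br b v)))"
        by (rule tr_diff[symmetric])
      also have "\<dots> = tr (\<lambda>v. (-1) *s br a (br (?D b) v))"
        unfolding dD br_add_right by simp
      also have "\<dots> = - kappa a (?D b)" unfolding tr_smult kappa_def by simp
      finally show ?thesis by (simp add: k0)
    qed
    have "subspace {z. tr (\<lambda>v. br z (?D v)) = 0}"
      by (simp add: subspace_def br_add_left br_scale_left tr_add tr_smult)
    then have "span {br x y |x y. True} \<subseteq> {z. tr (\<lambda>v. br z (?D v)) = 0}"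
      using 0 by (intro span_minimal) auto
    then show "tr (\<lambda>v. br x (?D v)) = 0" unfolding span_brackets by blast
  qed
  obtain a b where "br a b \<noteq> 0" using nonabelian by blast
  then have "{0} \<subset> (UNIV :: 'a set)" by blast
  then have "\<exists>w\<in>UNIV - {0}. \<forall>x\<in>UNIV. br x w \<in> {0}"
    by (intro engel) (simp_all add: nil)
  then obtain w where w: "w \<noteq> 0" "\<And>x. br x w = 0" by blast
  have "br w y = 0" for y using w(2)[of y] by (subst br_anticomm) simp
  then show False using center_zero w(1) by blast
qed

lemma kappa_nondegenerate:
  assumes "\<And>y. kappa x y = 0"
  shows "x = 0"
proof -
  let ?I = "{x. \<forall>y. kappa x y = 0}"
  have inv: "kappa (br z x) y = 0" if "\<forall>y. kappa x y = 0" for x z y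
  proof -
    have "br z x = (-1) *s br x z" using br_anticomm[of z x] by simp
    then show ?thesis using that by (simp add: kappa_scale_left kappa_invariant del: scale_minus_left)
  qed
  have "lie_ideal sg br ?I"
    unfolding lie_ideal_def
    by (simp add: subspace_def kappa_add_left kappa_scale_left inv)
  then have "?I = {0} \<or> ?I = UNIV" by (rule ideal_cases)
  moreover have "?I \<noteq> UNIV" using kappa_not_zero by blast
  ultimately show ?thesis using assms by blast
qed

text \<open>Nondegeneracy represents the functional sending \<open>y\<close> to the trace of
  \<open>D\<close> composed with \<open>ad y\<close> by some \<open>x\<close>. The difference
  \<open>E\<close> of \<open>D\<close> and \<open>ad x\<close> is a derivation with zero trace
  against every \<open>ad y\<close>; but \<open>kappa (E a) b\<close> is the trace of
  \<open>E\<close> composed with \<open>ad [a, b]\<close>, so \<open>E\<close> vanishes.\<close>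

lemma derivation_inner:
  assumes D: "derivation D"
  obtains x where "\<And>y. D y = br x y"
proof -
  have lD: "lin D" and dD: "\<And>a b. D (br a b) = br (D a) b + br a (D b)"
    using D unfolding derivation_def by blast+
  \<comment> \<open>The values of \<open>kappa x\<close> on a basis are packed into a vector of the
    same space, so that injectivity yields surjectivity without dual spaces.\<close>
  define \<Phi> where "\<Phi> x = (\<Sum>b\<in>Bg. kappa x b *s b)" for x
  have l\<Phi>: "lin \<Phi>"
    unfolding \<Phi>_def
    by (intro linI) (simp_all add: kappa_add_left kappa_scale_left scale_left_distrib sum.distrib scale_sum_right)
  have coeff: "f b = g b" if "(\<Sum>b\<in>Bg. f b *s b) = (\<Sum>b\<in>Bg. g b *s b)" "b \<in> Bg" for f g b
  proof -
    have "(\<Sum>b\<in>Bg. (f b - g b) *s b) = 0"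
      using that(1) by (simp add: scale_left_diff_distrib sum_subtractf)
    then have "f b - g b = 0"
      by (rule independentD[OF independent_Basis finite_Basis subset_refl, where u = "\<lambda>b. f b - g b"])
         (rule that(2))
    then show ?thesis by simp
  qed
  have "inj \<Phi>"
  proof (rule injI)
    fix x y assume "\<Phi> x = \<Phi> y"
    then have "kappa x b = kappa y b" if "b \<in> Bg" for b
      unfolding \<Phi>_def using coeff[of "kappa x" "kappa y"] that by blast
    then have "kappa (x - y) b = 0" if "b \<in> Bg" for b using that by (simp add: kappa_diff_left)
    then have "kappa (x - y) z = 0" for z by (rule kappa_zero_span[OF span_Basis])
    then have "x - y = 0" by (rule kappa_nondegenerate)
    then show "x = y" by simp
  qed
  then have "surj \<Phi>" by (rule linear_inj_imp_surj[OF l\<Phi>])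
  then obtain x where x: "\<Phi> x = (\<Sum>b\<in>Bg. tr (\<lambda>z. D (br b z)) *s b)" by (metis surjD)
  have eqb: "kappa x b = tr (\<lambda>z. D (br b z))" if "b \<in> Bg" for b
    using x that unfolding \<Phi>_def by (rule coeff)
  have eq: "kappa x y = tr (\<lambda>z. D (br y z))" for y
  proof -
    have "subspace {y. kappa x y = tr (\<lambda>z. D (br y z))}"
      by (simp add: subspace_def kappa_add_right kappa_scale_right br_add_left br_scale_left
          lin_add[OF lD] lin_scale[OF lD] tr_add tr_smult lin_zero[OF lD])
    then have "span Bg \<subseteq> {y. kappa x y = tr (\<lambda>z. D (br y z))}"
      using eqb by (intro span_minimal) auto
    then show ?thesis using span_Basis by blast
  qed
  define E where "E y = D y - br x y" for y
  have lE: "lin E" unfolding E_def by (rule lin_minus[OF lD lin_ad])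
  have trE: "tr (\<lambda>z. E (br y z)) = 0" for y
    unfolding E_def using eq[of y] by (simp add: tr_diff kappa_def)
  have dE: "E (br a b) = br (E a) b + br a (E b)" for a b
    unfolding E_def by (simp add: dD jacobi[of x a b] br_diff_left br_diff_right)
  have "E a = 0" for a
  proof (rule kappa_nondegenerate)
    fix b
    have "kappa (E a) b = tr (\<lambda>z. E (br a (br b z)) - br a (E (br b z)))"
      unfolding kappa_def by (simp add: dE)
    also have "\<dots> = tr (\<lambda>z. E (br a (br b z))) - tr (\<lambda>z. br a (E (br b z)))" by (rule tr_diff)
    also have "tr (\<lambda>z. br a (E (br b z))) = tr (\<lambda>z. E (br b (br a z)))"
      by (rule tr_comm[OF lin_ad lin_comp[OF lE lin_ad]])
    also have "tr (\<lambda>z. E (br a (br b z))) - \<dots> = tr (\<lambda>z. E (br (br a b) z))"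
      unfolding ad_br lin_diff[OF lE] by (rule tr_diff[symmetric])
    also have "\<dots> = 0" by (rule trE)
    finally show "kappa (E a) b = 0" .
  qed
  then have "D y = br x y" for y unfolding E_def by (metis right_minus_eq)
  then show ?thesis by (rule that)
qed

end

section \<open>Representations of \<open>sl\<^sub>2\<close>\<close>

text \<open>Three operators with the relations of a triple, so that the same results apply to
  \<open>br\<close>, \<open>rho\<close> and \<open>sigma\<close>.\<close>

locale sl2_rep = fd_complex_space +
  fixes E F Hh :: "'a \<Rightarrow> 'a"
  assumes lin_E: "lin E" and lin_F: "lin F" and lin_Hh: "lin Hh"
    and HE: "\<And>v. Hh (E v) = E (Hh v) + 2 *s E v"
    and HF: "\<And>v. Hh (F v) = F (Hh v) - 2 *s F v"
    and EF: "\<And>v. E (F v) = F (E v) + Hh v"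
begin

lemma loc_nilpotent_E: "loc_nilpotent E"
  by (rule loc_nilpotent_raising[OF lin_Hh lin_E HE]) simp

lemma loc_nilpotent_F: "loc_nilpotent F"
  by (rule loc_nilpotent_raising[OF lin_Hh lin_F, of "- 2"]) (simp_all add: HF)

lemma weight_F_pow:
  assumes "Hh u = m *s u"
  shows "Hh ((F ^^ k) u) = (m - 2 * of_nat k) *s (F ^^ k) u"
proof (induction k)
  case (Suc k)
  have "Hh ((F ^^ Suc k) u) = F (Hh ((F ^^ k) u)) - 2 *s (F ^^ Suc k) u" by (simp add: HF)
  also have "\<dots> = (m - 2 * of_nat k) *s (F ^^ Suc k) u - 2 *s (F ^^ Suc k) u"
    unfolding Suc by (simp add: lin_scale[OF lin_F])
  also have "\<dots> = (m - 2 * of_nat (Suc k)) *s (F ^^ Suc k) u"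
    unfolding scale_left_diff_distrib[symmetric] by (simp add: algebra_simps)
  finally show ?case .
qed (simp add: assms)

lemma weight_E_pow:
  assumes "Hh u = m *s u"
  shows "Hh ((E ^^ k) u) = (m + 2 * of_nat k) *s (E ^^ k) u"
proof (induction k)
  case (Suc k)
  have "Hh ((E ^^ Suc k) u) = E (Hh ((E ^^ k) u)) + 2 *s (E ^^ Suc k) u" by (simp add: HE)
  also have "\<dots> = (m + 2 * of_nat k) *s (E ^^ Suc k) u + 2 *s (E ^^ Suc k) u"
    unfolding Suc by (simp add: lin_scale[OF lin_E])
  also have "\<dots> = (m + 2 * of_nat (Suc k)) *s (E ^^ Suc k) u"
    unfolding scale_left_distrib[symmetric] by (simp add: algebra_simps)
  finally show ?case .
qed (simp add: assms)

lemma E_F_pow: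
  assumes "E u = 0" "Hh u = m *s u"
  shows "E ((F ^^ Suc k) u) = (of_nat (Suc k) * (m - of_nat k)) *s (F ^^ k) u"
proof (induction k)
  case 0
  then show ?case using assms lin_F by (simp add: EF)
next
  case (Suc k)
  have "E ((F ^^ Suc (Suc k)) u) = F (E ((F ^^ Suc k) u)) + Hh ((F ^^ Suc k) u)"
    by (simp only: funpow.simps o_apply EF)
  also have "\<dots> = (of_nat (Suc k) * (m - of_nat k)) *s (F ^^ Suc k) u
      + (m - 2 * of_nat (Suc k)) *s (F ^^ Suc k) u"
    unfolding Suc weight_F_pow[OF assms(2)] by (simp add: lin_scale[OF lin_F])
  also have "\<dots> = (of_nat (Suc (Suc k)) * (m - of_nat (Suc k))) *s (F ^^ Suc k) u"
    unfolding scale_left_distrib[symmetric] by (simp add: algebra_simps)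
  finally show ?case .
qed

text \<open>The scalar is the product of \<open>of_nat (Suc i) * (m - of_nat i)\<close> over
  \<open>i < n\<close>, so the excluded values of \<open>m\<close> are its zeros.\<close>

lemma E_pow_F_pow:
  assumes u: "E u = 0" "Hh u = m *s u" and m: "\<And>i. i < n \<Longrightarrow> m \<noteq> of_nat i"
  shows "\<exists>c. c \<noteq> 0 \<and> (E ^^ n) ((F ^^ n) u) = c *s u"
  using m
proof (induction n)
  case 0
  show ?case by (intro exI[of _ 1]) simp
next
  case (Suc n)
  then obtain c where c: "c \<noteq> 0" "(E ^^ n) ((F ^^ n) u) = c *s u" by auto
  let ?d = "of_nat (Suc n) * (m - of_nat n)"
  have "(E ^^ Suc n) ((F ^^ Suc n) u) = (E ^^ n) (E ((F ^^ Suc n) u))"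
    by (simp only: funpow_Suc_right o_apply)
  also have "\<dots> = (?d * c) *s u"
    unfolding E_F_pow[OF u] by (simp add: lin_scale[OF lin_funpow[OF lin_E]] c(2))
  finally have eq: "(E ^^ Suc n) ((F ^^ Suc n) u) = (?d * c) *s u" .
  have "(of_nat (Suc n) :: complex) \<noteq> 0" by (simp del: of_nat_Suc)
  then have "?d * c \<noteq> 0" using c(1) Suc.prems[of n] by (simp del: of_nat_Suc)
  with eq show ?case by blast
qed

lemma least_power_zero:
  assumes "loc_nilpotent A" "v \<noteq> 0"
  obtains k where "(A ^^ Suc k) v = 0" "(A ^^ k) v \<noteq> 0"
proof -
  have ex: "\<exists>k. (A ^^ k) v = 0" using assms(1) unfolding loc_nilpotent_def by blast
  define j where "j = (LEAST k. (A ^^ k) v = 0)"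
  have j: "(A ^^ j) v = 0" unfolding j_def by (rule LeastI_ex[OF ex])
  then obtain k where k: "j = Suc k" using assms(2) by (cases j) auto
  have "(A ^^ k) v \<noteq> 0" using not_less_Least[of k "\<lambda>k. (A ^^ k) v = 0"] k unfolding j_def by simp
  then show ?thesis using that j k by blast
qed

text \<open>Raising \<open>v\<close> to a vector killed by \<open>E\<close> and then lowering until
  \<open>0\<close> forces the top weight \<open>c + 2 * k\<close> to equal the length
  \<open>j\<close> of the string. The weight is even an integer, but reality is what the positivity
  argument uses.\<close>

lemma weight_real:
  assumes "v \<noteq> 0" "Hh v = c *s v"
  shows "\<exists>r::real. c = of_real r"
proof -
  obtain k where k: "(E ^^ Suc k) v = 0" "(E ^^ k) v \<noteq> 0"
    using least_power_zero[OF loc_nilpotent_E assms(1)] by blast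
  define u where "u = (E ^^ k) v"
  have u: "E u = 0" "Hh u = (c + 2 * of_nat k) *s u" "u \<noteq> 0"
    using k weight_E_pow[OF assms(2)] unfolding u_def by simp_all
  obtain j where j: "(F ^^ Suc j) u = 0" "(F ^^ j) u \<noteq> 0"
    using least_power_zero[OF loc_nilpotent_F u(3)] by blast
  have "(of_nat (Suc j) * (c + 2 * of_nat k - of_nat j)) *s (F ^^ j) u = 0"
    using E_F_pow[OF u(1,2), of j] j(1) lin_E by simp
  then have "c + 2 * of_nat k - of_nat j = 0" using j(2) by (simp add: of_nat_Suc[symmetric] del: of_nat_Suc)
  then have "c = of_real (real j - 2 * real k)" by (simp add: algebra_simps)
  then show ?thesis by blast
qed

text \<open>A lowest weight vector of the quotient by \<open>U\<close> cannot have positive weight.\<close>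

lemma lowering_injective_mod:
  fixes r :: real
  assumes U: "subspace U" "\<And>v. v \<in> U \<Longrightarrow> E v \<in> U" "\<And>v. v \<in> U \<Longrightarrow> F v \<in> U"
    and v: "F v \<in> U" "Hh v = of_real r *s v" "r > 0"
  shows "v \<in> U"
proof -
  \<comment> \<open>This is the mirror image of \<open>E_F_pow\<close> modulo \<open>U\<close>, with
    \<open>v\<close> as lowest weight vector. As \<open>r > 0\<close> no coefficient vanishes, so
    membership in \<open>U\<close> descends from a power of \<open>E\<close> that kills
    \<open>v\<close> to \<open>v\<close> itself.\<close>
  have F: "F ((E ^^ Suc k) v) + (of_nat (Suc k) * (of_real r + of_nat k)) *s (E ^^ k) v \<in> U" for k
  proof (induction k)
    case 0
    have "F (E v) + of_real r *s v = E (F v)" by (simp add: EF v(2))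
    then show ?case using U(2)[OF v(1)] by simp
  next
    case (Suc k)
    let ?w = "(E ^^ Suc k) v" and ?c = "of_nat (Suc k) * (of_real r + of_nat k) :: complex"
    have "E (F ?w + ?c *s (E ^^ k) v) = E (F ?w) + ?c *s ?w"
      by (simp add: lin_add[OF lin_E] lin_scale[OF lin_E])
    also have "E (F ?w) = F (E ?w) + (of_real r + 2 * of_nat (Suc k)) *s ?w"
      unfolding EF weight_E_pow[OF v(2)] ..
    also have "\<dots> + ?c *s ?w = F (E ?w) + ((of_real r + 2 * of_nat (Suc k)) + ?c) *s ?w"
      by (simp only: scale_left_distrib add.assoc)
    also have "(of_real r + 2 * of_nat (Suc k)) + ?c = of_nat (Suc (Suc k)) * (of_real r + of_nat (Suc k))"
      by (simp add: algebra_simps)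
    finally show ?case using U(2)[OF Suc] by simp
  qed
  have "(E ^^ n) v \<in> U \<Longrightarrow> v \<in> U" for n
  proof (induction n)
    case (Suc n)
    have "(of_nat (Suc n) * (of_real r + of_nat n)) *s (E ^^ n) v \<in> U"
      using subspace_diff[OF U(1) F[of n] U(3)[OF Suc.prems]] by simp
    moreover have nz: "of_nat (Suc n) * (of_real r + of_nat n) \<noteq> (0::complex)"
    proof -
      have "(of_real r + of_nat n :: complex) = of_real (r + real n)" by simp
      moreover have "r + real n \<noteq> 0" using v(3) by simp
      ultimately show ?thesis by (metis mult_eq_0_iff of_nat_eq_0_iff of_real_eq_0_iff nat.distinct(1))
    qed
    ultimately have "(E ^^ n) v \<in> U"
      using subspace_scale[OF U(1), of _ "inverse (of_nat (Suc n) * (of_real r + of_nat n))"]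
      by (metis left_inverse scale_one scale_scale)
    then show ?case by (rule Suc.IH)
  qed simp
  moreover obtain n where "(E ^^ n) v = 0" using loc_nilpotent_E unfolding loc_nilpotent_def by blast
  ultimately show ?thesis using subspace_0[OF U(1)] by metis
qed

end

section \<open>Root space decomposition\<close>

locale cartan_lie = simple_fd_lie +
  fixes H :: "'a set"
  assumes cartan: "cartan_subalgebra sg br H"
begin

lemma subspace_H: "subspace H"
  and br_H_H: "x \<in> H \<Longrightarrow> y \<in> H \<Longrightarrow> br x y = 0"
  and maximal_H: "toral sg br T \<Longrightarrow> H \<subseteq> T \<Longrightarrow> T = H"
  using cartan unfolding cartan_subalgebra_def toral_def by blast+

lemma diagonalizable_H: "h \<in> H \<Longrightarrow> diagonalizable (br h)"
  using cartan unfolding cartan_subalgebra_def toral_def ad_semisimple_def diagonalizable_def by blast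

text \<open>The index is any function, of which only the values on \<open>H\<close> matter; no
  linearity has to be carried along. The index \<open>0\<close> gives the centralizer of
  \<open>H\<close>.\<close>

definition root_space :: "('a \<Rightarrow> complex) \<Rightarrow> 'a set" where
  "root_space \<alpha> = {x. \<forall>h\<in>H. br h x = \<alpha> h *s x}"

lemma root_spaceI: "(\<And>h. h \<in> H \<Longrightarrow> br h x = \<alpha> h *s x) \<Longrightarrow> x \<in> root_space \<alpha>"
  and root_spaceD: "x \<in> root_space \<alpha> \<Longrightarrow> h \<in> H \<Longrightarrow> br h x = \<alpha> h *s x"
  unfolding root_space_def by blast+

lemma subspace_root_space: "subspace (root_space \<alpha>)"
  by (simp add: subspace_def root_space_def br_add_right br_scale_right scale_right_distrib mult.commute)

text \<open>Simultaneous diagonalization is available for finitely many operators, so it is applied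
  to a basis of \<open>H\<close>; linearity of \<open>ad\<close> turns its common eigenvectors into
  common eigenvectors of \<open>H\<close>.\<close>

lemma span_root_spaces: "span (\<Union>\<alpha>. root_space \<alpha>) = UNIV"
proof -
  obtain F where F: "finite F" "F \<subseteq> H" "span F = H"
    using basis_subspace_exists[OF subspace_H] by metis
  have com: "br x (br y v) = br y (br x v)" if "x \<in> F" "y \<in> F" for x y v
  proof -
    have "br x y = 0" using that F(2) br_H_H by blast
    then show ?thesis by (simp add: jacobi[of x y v])
  qed
  have "span {v. \<forall>X\<in>br ` F. \<exists>c. X v = c *s v} = UNIV"
  proof (rule simultaneously_diagonalizable)
    show "finite (br ` F)" using F(1) by simp
    show "lin X" if "X \<in> br ` F" for X using that lin_ad by blast
    show "diagonalizable X" if "X \<in> br ` F" for X using that F(2) diagonalizable_H by blast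
    show "X (Y v) = Y (X v)" if XY: "X \<in> br ` F" "Y \<in> br ` F" for X Y v
    proof -
      obtain x y where "x \<in> F" "X = br x" "y \<in> F" "Y = br y" using XY by blast
      then show ?thesis using com by simp
    qed
  qed
  moreover have "{v. \<forall>X\<in>br ` F. \<exists>c. X v = c *s v} \<subseteq> (\<Union>\<alpha>. root_space \<alpha>)"
  proof
    fix v assume v: "v \<in> {v. \<forall>X\<in>br ` F. \<exists>c. X v = c *s v}"
    have "subspace {h. \<exists>c. br h v = c *s v}"
    proof (rule subspaceI)
      show "0 \<in> {h. \<exists>c. br h v = c *s v}" by (auto intro: exI[of _ 0])
    next
      fix x y assume "x \<in> {h. \<exists>c. br h v = c *s v}" "y \<in> {h. \<exists>c. br h v = c *s v}"
      then obtain a b where "br x v = a *s v" "br y v = b *s v" by blast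
      then have "br (x + y) v = (a + b) *s v" by (simp add: br_add_left scale_left_distrib)
      then show "x + y \<in> {h. \<exists>c. br h v = c *s v}" by blast
    next
      fix k x assume "x \<in> {h. \<exists>c. br h v = c *s v}"
      then obtain a where "br x v = a *s v" by blast
      then have "br (k *s x) v = (k * a) *s v" by (simp add: br_scale_left)
      then show "k *s x \<in> {h. \<exists>c. br h v = c *s v}" by blast
    qed
    then have "span F \<subseteq> {h. \<exists>c. br h v = c *s v}" using v by (intro span_minimal) auto
    then have "\<forall>h\<in>H. \<exists>c. br h v = c *s v" using F(3) by blast
    from bchoice[OF this] obtain \<alpha> where "\<forall>h\<in>H. br h v = \<alpha> h *s v" by blast
    then show "v \<in> (\<Union>\<alpha>. root_space \<alpha>)" unfolding root_space_def by blast
  qed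
  ultimately show ?thesis using span_mono by blast
qed

lemma br_root_space:
  assumes "x \<in> root_space \<alpha>" "y \<in> root_space \<beta>"
  shows "br x y \<in> root_space (\<alpha> + \<beta>)"
proof (rule root_spaceI)
  fix h assume h: "h \<in> H"
  show "br h (br x y) = (\<alpha> + \<beta>) h *s br x y"
    unfolding jacobi[of h x y] root_spaceD[OF assms(1) h] root_spaceD[OF assms(2) h]
    by (simp add: br_scale_left br_scale_right scale_left_distrib)
qed

lemma kappa_root_spaces:
  assumes x: "x \<in> root_space \<alpha>" and y: "y \<in> root_space \<beta>" and h: "h \<in> H" "\<alpha> h + \<beta> h \<noteq> 0"
  shows "kappa x y = 0"
proof -
  have "kappa (br x h) y = kappa x (br h y)" by (rule kappa_invariant)
  moreover have "br x h = (- \<alpha> h) *s x"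
    using br_anticomm[of x h] root_spaceD[OF x h(1)] by simp
  ultimately have "- \<alpha> h * kappa x y = \<beta> h * kappa x y"
    using root_spaceD[OF y h(1)] by (simp only: kappa_scale_left kappa_scale_right)
  then have "\<beta> h * kappa x y = - (\<alpha> h * kappa x y)" by simp
  then have "(\<alpha> h + \<beta> h) * kappa x y = 0" by (simp add: distrib_right)
  then show ?thesis using h(2) by simp
qed

section \<open>The centralizer of the Cartan subalgebra\<close>

lemma H_subset_root_space_0: "h \<in> H \<Longrightarrow> h \<in> root_space 0"
  by (rule root_spaceI) (simp add: br_H_H)

lemma root_space_0D: "x \<in> root_space 0 \<Longrightarrow> h \<in> H \<Longrightarrow> br h x = 0"
  by (drule (1) root_spaceD) simp

lemma root_space_0D': "x \<in> root_space 0 \<Longrightarrow> h \<in> H \<Longrightarrow> br x h = 0"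
  by (subst br_anticomm) (simp add: root_space_0D)

lemma kappa_root_space_0_nondegenerate:
  assumes x: "x \<in> root_space 0" and "\<And>y. y \<in> root_space 0 \<Longrightarrow> kappa x y = 0"
  shows "x = 0"
proof (rule kappa_nondegenerate)
  fix y
  show "kappa x y = 0"
  proof (rule kappa_zero_span[OF span_root_spaces])
    fix y assume "y \<in> (\<Union>\<alpha>. root_space \<alpha>)"
    then obtain \<alpha> where y: "y \<in> root_space \<alpha>" by blast
    show "kappa x y = 0"
    proof (cases "\<exists>h\<in>H. \<alpha> h \<noteq> 0")
      case True
      then obtain h where "h \<in> H" "\<alpha> h \<noteq> 0" by blast
      then show ?thesis using kappa_root_spaces[OF x y] by simp
    next
      case False
      then have "y \<in> root_space 0" using y unfolding root_space_def by simp
      then show ?thesis by (rule assms(2))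
    qed
  qed
qed

text \<open>The semisimple part of \<open>ad x\<close> is a derivation, hence equals
  \<open>ad s\<close> for some \<open>s\<close>. It commutes with \<open>ad h\<close> for
  \<open>h\<close> in \<open>H\<close>, so \<open>H\<close> together with \<open>s\<close> spans a
  toral subalgebra, and maximality puts \<open>s\<close> into \<open>H\<close>.\<close>

lemma jordan_root_space_0:
  assumes x: "x \<in> root_space 0"
  obtains s where "s \<in> H" "loc_nilpotent (br (x - s))"
proof -
  let ?S = "ss_part (br x)"
  have "derivation ?S" by (rule derivation_diag_op) simp
  then obtain s where s: "\<And>y. ?S y = br s y" using derivation_inner by blast
  have hs: "br h s = 0" if h: "h \<in> H" for h
  proof (rule center_zero)
    fix y
    have "br h (?S y) = ?S (br h y)"
    proof (rule diag_op_commute[OF lin_ad lin_ad])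
      show "br h (br x z) = br x (br h z)" for z
        by (simp add: jacobi[of h x z] root_space_0D[OF x h])
    qed
    then show "br (br h s) y = 0" unfolding s by (simp add: ad_br)
  qed
  define T where "T = {h + c *s s |h c. h \<in> H}"
  have Tsub: "subspace T"
  proof (rule subspaceI)
    show "0 \<in> T" unfolding T_def using subspace_0[OF subspace_H] by (intro CollectI exI[of _ 0]) simp
  next
    fix a b assume "a \<in> T" "b \<in> T"
    then obtain h c h' c' where "a = h + c *s s" "h \<in> H" "b = h' + c' *s s" "h' \<in> H"
      unfolding T_def by blast
    moreover from this have "a + b = (h + h') + (c + c') *s s" by (simp add: scale_left_distrib algebra_simps)
    ultimately show "a + b \<in> T" unfolding T_def using subspace_add[OF subspace_H] by blast
  next
    fix k a assume "a \<in> T"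
    then obtain h c where "a = h + c *s s" "h \<in> H" unfolding T_def by blast
    moreover from this have "k *s a = k *s h + (k * c) *s s" by (simp add: scale_right_distrib)
    ultimately show "k *s a \<in> T" unfolding T_def using subspace_scale[OF subspace_H] by blast
  qed
  have sh: "br s h = 0" if "h \<in> H" for h using hs[OF that] by (subst br_anticomm) simp
  have Tab: "br a b = 0" if ab: "a \<in> T" "b \<in> T" for a b
  proof -
    obtain h c h' c' where "a = h + c *s s" "h \<in> H" "b = h' + c' *s s" "h' \<in> H"
      using ab unfolding T_def by blast
    then show ?thesis
      by (simp add: br_add_left br_add_right br_scale_left br_scale_right hs sh br_H_H)
  qed
  have Tss: "ad_semisimple sg br a" if a: "a \<in> T" for a
  proof -
    obtain h c where h: "a = h + c *s s" "h \<in> H" using a unfolding T_def by blast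
    have "br s = ?S" using s by (simp add: fun_eq_iff)
    then have ds: "diagonalizable (br s)" using diagonalizable_diag_op[OF lin_ad] by metis
    have com: "br h (br s v) = br s (br h v)" for v by (simp add: jacobi[of h s v] hs[OF h(2)])
    have "span {v. \<forall>X\<in>{br h, br s}. \<exists>c. X v = c *s v} = UNIV"
      by (rule simultaneously_diagonalizable)
         (use ds diagonalizable_H[OF h(2)] lin_ad com in auto)
    moreover have "{v. \<forall>X\<in>{br h, br s}. \<exists>c. X v = c *s v} \<subseteq> {y. \<exists>c. br a y = c *s y}"
    proof
      fix v assume "v \<in> {v. \<forall>X\<in>{br h, br s}. \<exists>c. X v = c *s v}"
      then obtain p q where "br h v = p *s v" "br s v = q *s v" by blast
      then have "br a v = (p + c * q) *s v"
        unfolding h(1) by (simp add: br_add_left br_scale_left scale_left_distrib)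
      then show "v \<in> {y. \<exists>c. br a y = c *s y}" by blast
    qed
    ultimately show ?thesis unfolding ad_semisimple_def using span_mono by blast
  qed
  have "toral sg br T" unfolding toral_def using Tsub Tab Tss by blast
  moreover have "H \<subseteq> T"
  proof
    fix h assume "h \<in> H"
    moreover have "h = h + 0 *s s" by simp
    ultimately show "h \<in> T" unfolding T_def by blast
  qed
  ultimately have "T = H" by (rule maximal_H)
  moreover have "s \<in> T"
  proof -
    have "s = 0 + 1 *s s" by simp
    then show ?thesis unfolding T_def using subspace_0[OF subspace_H] by blast
  qed
  moreover have "loc_nilpotent (br (x - s))"
    using loc_nilpotent_minus_ss_part[OF lin_ad, of x] unfolding s br_diff_left[symmetric] .
  ultimately show ?thesis using that by blast
qed

lemma kappa_nilpotent_commuting: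
  assumes "loc_nilpotent (br n)" "br n y = 0"
  shows "kappa n y = 0"
proof -
  have com: "br y (br n z) = br n (br y z)" for z
    using assms(2) by (simp add: jacobi[of n y z])
  have "loc_nilpotent (\<lambda>z. br y (br n z))"
    by (rule loc_nilpotent_commuting_comp[OF lin_ad assms(1) lin_ad com])
  then have "kappa y n = 0" unfolding kappa_def by (rule tr_nilpotent[OF lin_ad2])
  then show ?thesis by (simp add: kappa_comm)
qed

text \<open>An element of the centralizer is an \<open>s\<close> in \<open>H\<close> plus a
  nilpotent element commuting with \<open>u\<close>, and the nilpotent part is orthogonal to
  \<open>u\<close>. So orthogonality to \<open>H\<close> extends to the centralizer.\<close>

lemma kappa_H_nondegenerate:
  assumes u: "u \<in> H" and "\<And>h. h \<in> H \<Longrightarrow> kappa u h = 0"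
  shows "u = 0"
proof (rule kappa_root_space_0_nondegenerate[OF H_subset_root_space_0[OF u]])
  fix y assume y: "y \<in> root_space 0"
  obtain s where s: "s \<in> H" "loc_nilpotent (br (y - s))" using jordan_root_space_0[OF y] by blast
  have "br (y - s) u = 0" using root_space_0D'[OF y u] br_H_H[OF s(1) u] by (simp add: br_diff_left)
  then have "kappa u (y - s) = 0" using kappa_nilpotent_commuting[OF s(2)] kappa_comm by metis
  then show "kappa u y = 0" using assms(2)[OF s(1)] by (simp add: kappa_diff_right)
qed

text \<open>Nilpotent elements of the centralizer form a subspace because the toral part of
  \<open>x\<close> is determined by the values \<open>kappa x h\<close>, which are linear in \<open>x\<close>.\<close>

lemma root_space_0_eq_H: "root_space 0 = H"
proof -
  define N where "N = {x \<in> root_space 0. loc_nilpotent (br x)}"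
  have NH: "kappa n h = 0" if "n \<in> N" "h \<in> H" for n h
    using that kappa_nilpotent_commuting root_space_0D' unfolding N_def by blast
  have add: "n + n' \<in> N" if n: "n \<in> N" "n' \<in> N" for n n'
  proof -
    have x: "n + n' \<in> root_space 0" using n subspace_add[OF subspace_root_space] unfolding N_def by blast
    obtain s where s: "s \<in> H" "loc_nilpotent (br (n + n' - s))" using jordan_root_space_0[OF x] by blast
    have mem: "n + n' - s \<in> N"
      using s subspace_diff[OF subspace_root_space x H_subset_root_space_0] unfolding N_def by blast
    have "s = 0"
    proof (rule kappa_H_nondegenerate[OF s(1)])
      fix h assume h: "h \<in> H"
      have "kappa (n + n' - s) h = 0" by (rule NH[OF mem h])
      then show "kappa s h = 0" by (simp add: kappa_diff_left kappa_add_left NH n h)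
    qed
    then show ?thesis using mem by simp
  qed
  have NN0: "kappa n n = 0" if "n \<in> N" for n
    using that by (intro kappa_nilpotent_commuting) (simp_all add: N_def)
  \<comment> \<open>Polarisation of \<open>NN0\<close>, possible because \<open>N\<close> is closed
    under addition; \<open>n\<close> and \<open>n'\<close> are not yet known to commute.\<close>
  have NN: "kappa n n' = 0" if n: "n \<in> N" "n' \<in> N" for n n'
  proof -
    have "kappa (n + n') (n + n') = 0" by (rule NN0[OF add[OF n]])
    then have "kappa n n' + kappa n' n = 0"
      by (simp add: kappa_add_left kappa_add_right NN0 n add.commute)
    then show ?thesis by (simp add: kappa_comm[of n' n])
  qed
  have N0: "n = 0" if n: "n \<in> N" for n
  proof (rule kappa_root_space_0_nondegenerate)
    show "n \<in> root_space 0" using n unfolding N_def by simp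
    fix y assume y: "y \<in> root_space 0"
    obtain s where s: "s \<in> H" "loc_nilpotent (br (y - s))" using jordan_root_space_0[OF y] by blast
    have "y - s \<in> N"
      using s subspace_diff[OF subspace_root_space y H_subset_root_space_0] unfolding N_def by blast
    then have "kappa n (y - s) = 0" by (rule NN[OF n])
    then show "kappa n y = 0" by (simp add: kappa_diff_right NH[OF n s(1)])
  qed
  show ?thesis
  proof
    show "H \<subseteq> root_space 0" using H_subset_root_space_0 by blast
    show "root_space 0 \<subseteq> H"
    proof
      fix x assume x: "x \<in> root_space 0"
      obtain s where s: "s \<in> H" "loc_nilpotent (br (x - s))" using jordan_root_space_0[OF x] by blast
      have "x - s \<in> N"
        using s subspace_diff[OF subspace_root_space x H_subset_root_space_0] unfolding N_def by blast
      then have "x - s = 0" by (rule N0)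
      then show "x \<in> H" using s(1) by simp
    qed
  qed
qed

subsection \<open>Root triples and positivity\<close>

definition sl2_triple :: "'a \<Rightarrow> 'a \<Rightarrow> 'a \<Rightarrow> bool" where
  "sl2_triple e f h \<longleftrightarrow> br e f = h \<and> br h e = 2 *s e \<and> br h f = - (2 *s f)"

lemma sl2_triple_swap: "sl2_triple e f h \<Longrightarrow> sl2_triple f e (- h)"
  unfolding sl2_triple_def using br_anticomm[of f e] by (simp add: br_minus_left)

lemma exists_sl2_triple:
  assumes x: "x \<in> root_space \<alpha>" "x \<noteq> 0" and h0: "h0 \<in> H" "\<alpha> h0 \<noteq> 0"
  obtains y h k where "y \<in> root_space (- \<alpha>)" "h \<in> H" "sl2_triple x y h"
    "\<And>h'. h' \<in> H \<Longrightarrow> kappa h h' = k * \<alpha> h'"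
proof -
  have "\<exists>\<beta> y. y \<in> root_space \<beta> \<and> kappa x y \<noteq> 0"
  proof (rule ccontr)
    assume "\<not> ?thesis"
    then have "\<And>y. y \<in> (\<Union>\<beta>. root_space \<beta>) \<Longrightarrow> kappa x y = 0" by blast
    then have "kappa x y = 0" for y by (rule kappa_zero_span[OF span_root_spaces])
    then show False using kappa_nondegenerate x(2) by blast
  qed
  then obtain \<beta> y where y: "y \<in> root_space \<beta>" "kappa x y \<noteq> 0" by blast
  have "\<beta> h = - \<alpha> h" if "h \<in> H" for h
    using kappa_root_spaces[OF x(1) y(1) that] y(2) by (metis add_eq_0_iff)
  then have ym: "y \<in> root_space (- \<alpha>)" using y(1) unfolding root_space_def by simp
  define t where "t = br x y"
  have "t \<in> root_space (\<alpha> + - \<alpha>)" unfolding t_def by (rule br_root_space[OF x(1) ym])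
  then have t: "t \<in> H" using root_space_0_eq_H by simp
  have kt: "kappa t h = kappa x y * \<alpha> h" if h: "h \<in> H" for h
  proof -
    have "br y h = \<alpha> h *s y" using br_anticomm[of y h] root_spaceD[OF ym h] by simp
    then show ?thesis unfolding t_def by (simp add: kappa_invariant kappa_scale_right)
  qed
  have t0: "t \<noteq> 0" using kt[OF h0(1)] y(2) h0(2) by auto
  have tx: "br t x = \<alpha> t *s x" by (rule root_spaceD[OF x(1) t])
  have ty: "br t y = - (\<alpha> t *s y)" using root_spaceD[OF ym t] by simp
  \<comment> \<open>Otherwise \<open>y\<close> commutes with \<open>t\<close> and thus with
    \<open>?D\<close>, so the trace of \<open>ad t\<close> against \<open>?D\<close> cancels by
    cyclicity. Then \<open>ad t\<close> is nilpotent and diagonalizable, hence zero, although the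
    center is trivial.\<close>
  have at: "\<alpha> t \<noteq> 0"
  proof
    assume a0: "\<alpha> t = 0"
    let ?D = "diag_op cnj (br t)"
    have D: "lin ?D" by (rule lin_diag_op[OF lin_ad])
    have comD: "br y (?D v) = ?D (br y v)" for v
    proof (rule diag_op_commute[OF lin_ad lin_ad])
      show "br y (br t z) = br t (br y z)" for z using ty a0 by (simp add: jacobi[of t y z])
    qed
    have "tr (\<lambda>v. br t (?D v)) = tr (\<lambda>v. br x (br y (?D v))) - tr (\<lambda>v. br y (br x (?D v)))"
      unfolding t_def ad_br by (rule tr_diff)
    also have "tr (\<lambda>v. br y (br x (?D v))) = tr (\<lambda>v. br x (?D (br y v)))"
      by (rule tr_comm[OF lin_ad lin_comp[OF lin_ad D]])
    also have "\<dots> = tr (\<lambda>v. br x (br y (?D v)))" unfolding comD ..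
    finally have "tr (\<lambda>v. br t (?D v)) = 0" by simp
    then have "loc_nilpotent (br t)" by (rule loc_nilpotent_if_tr_cnj[OF lin_ad])
    then have "br t v = 0" for v by (rule diagonalizable_nilpotent[OF lin_ad diagonalizable_H[OF t]])
    then show False using center_zero t0 by blast
  qed
  \<comment> \<open>The scaling that makes \<open>x\<close> an eigenvector of \<open>c *s t\<close>
    with eigenvalue 2.\<close>
  define c where "c = 2 / \<alpha> t"
  show ?thesis
  proof (rule that)
    show "c *s y \<in> root_space (- \<alpha>)" by (rule subspace_scale[OF subspace_root_space ym])
    show "c *s t \<in> H" by (rule subspace_scale[OF subspace_H t])
    show "sl2_triple x (c *s y) (c *s t)"
      unfolding sl2_triple_def using at
      by (simp add: br_scale_right br_scale_left tx ty t_def[symmetric] c_def)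
    show "kappa (c *s t) h' = (c * kappa x y) * \<alpha> h'" if "h' \<in> H" for h'
      by (simp add: kappa_scale_left kt[OF that])
  qed
qed

lemma sl2_rep_ad:
  assumes "sl2_triple e f h"
  shows "sl2_rep sg Bg (br e) (br f) (br h)"
proof (intro sl2_rep.intro sl2_rep_axioms.intro fd_complex_space_axioms)
  show "lin (br e)" "lin (br f)" "lin (br h)" by (rule lin_ad)+
  show "br h (br e v) = br e (br h v) + 2 *s br e v" for v
    using assms by (simp add: jacobi[of h e v] sl2_triple_def br_scale_left)
  show "br h (br f v) = br f (br h v) - 2 *s br f v" for v
    using assms by (simp add: jacobi[of h f v] sl2_triple_def br_scale_left br_minus_left)
  show "br e (br f v) = br f (br e v) + br h v" for v
    using assms by (simp add: jacobi[of e f v] sl2_triple_def)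
qed

text \<open>Unlike in \<open>roots\<close>, nothing is required off \<open>H\<close>: the indices
  produced by \<open>span_root_spaces\<close> are arbitrary there.\<close>

definition is_root :: "('a \<Rightarrow> complex) \<Rightarrow> bool" where
  "is_root \<alpha> \<longleftrightarrow> (\<exists>h\<in>H. \<alpha> h \<noteq> 0) \<and> (\<exists>x\<in>root_space \<alpha>. x \<noteq> 0)"

text \<open>\<open>h\<close> is the coroot and \<open>k\<close> its ratio to the Killing dual of
  \<open>\<alpha>\<close>. The last clause records that every eigenvalue of \<open>ad h\<close> is
  real, which is what makes sums over several triples comparable with \<open>0\<close>.\<close>

definition root_triple :: "('a \<Rightarrow> complex) \<Rightarrow> 'a \<Rightarrow> 'a \<Rightarrow> 'a \<Rightarrow> real \<Rightarrow> bool" where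
  "root_triple \<alpha> e f h k \<longleftrightarrow> e \<in> root_space \<alpha> \<and> f \<in> root_space (- \<alpha>) \<and> h \<in> H \<and> sl2_triple e f h
     \<and> k > 0 \<and> (\<forall>h'\<in>H. kappa h h' = of_real k * \<alpha> h')
     \<and> (\<forall>\<gamma>. \<forall>z\<in>root_space \<gamma>. z \<noteq> 0 \<longrightarrow> (\<exists>r::real. \<gamma> h = of_real r))"

lemma kappa_self_real:
  assumes h: "h \<in> H" "h \<noteq> 0"
    and real: "\<And>\<gamma> z. z \<in> root_space \<gamma> \<Longrightarrow> z \<noteq> 0 \<Longrightarrow> \<exists>r::real. \<gamma> h = of_real r"
  obtains q :: real where "q > 0" "kappa h h = of_real q"
proof -
  have eig: "\<exists>r::real. br h v = of_real r *s v" if v': "v \<in> (\<Union>\<gamma>. root_space \<gamma>)" for v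
  proof (cases "v = 0")
    case True
    then show ?thesis by simp
  next
    case False
    obtain \<gamma> where v: "v \<in> root_space \<gamma>" using v' by blast
    then obtain r :: real where "\<gamma> h = of_real r" using real False by blast
    then show ?thesis using root_spaceD[OF v h(1)] by auto
  qed
  obtain q :: real where q: "q \<ge> 0" "tr (\<lambda>z. br h (br h z)) = of_real q" "q = 0 \<Longrightarrow> \<forall>v. br h v = 0"
    using tr_square_real[OF lin_ad span_root_spaces eig] by blast
  have "q \<noteq> 0" using q(3) center_zero h(2) by blast
  then show ?thesis using that[of q] q(1,2) unfolding kappa_def by simp
qed

lemma exists_root_triple:
  assumes "is_root \<alpha>"
  shows "\<exists>e f h k. root_triple \<alpha> e f h k"
proof -
  obtain x h0 where x: "x \<in> root_space \<alpha>" "x \<noteq> 0" "h0 \<in> H" "\<alpha> h0 \<noteq> 0"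
    using assms unfolding is_root_def by blast
  obtain y h k where y: "y \<in> root_space (- \<alpha>)" "h \<in> H" "sl2_triple x y h"
    and k: "\<And>h'. h' \<in> H \<Longrightarrow> kappa h h' = k * \<alpha> h'"
    using exists_sl2_triple[OF x] by blast
  interpret sl2_rep sg Bg "br x" "br y" "br h" by (rule sl2_rep_ad[OF y(3)])
  have real: "\<exists>r::real. \<gamma> h = of_real r" if "z \<in> root_space \<gamma>" "z \<noteq> 0" for z \<gamma>
    by (rule weight_real[OF that(2) root_spaceD[OF that(1) y(2)]])
  have hx: "br h x = 2 *s x" using y(3) unfolding sl2_triple_def by blast
  then have "h \<noteq> 0" using x(2) by auto
  then obtain q :: real where q: "q > 0" "kappa h h = of_real q"
    using kappa_self_real[OF y(2)] real by blast
  have "\<alpha> h *s x = 2 *s x" using root_spaceD[OF x(1) y(2)] hx by simp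
  then have "\<alpha> h = 2" using x(2) by simp
  \<comment> \<open>Evaluating the duality relation at \<open>h\<close> itself, where
    \<open>\<alpha>\<close> is 2, identifies \<open>k\<close> as half of
    \<open>kappa h h\<close>.\<close>
  then have "k * 2 = of_real q" using k[OF y(2)] q(2) by simp
  then have k2: "k = of_real (q / 2)" by (simp add: field_simps)
  have "root_triple \<alpha> x y h (q / 2)"
    unfolding root_triple_def using x(1) y q(1) real k unfolding k2 by auto
  then show ?thesis by blast
qed

lemma is_root_uminus:
  assumes "is_root \<alpha>"
  shows "is_root (- \<alpha>)"
proof -
  obtain x h0 where x: "x \<in> root_space \<alpha>" "x \<noteq> 0" "h0 \<in> H" "\<alpha> h0 \<noteq> 0"
    using assms unfolding is_root_def by blast
  obtain y h k where y: "y \<in> root_space (- \<alpha>)" "h \<in> H" "sl2_triple x y h"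
    using exists_sl2_triple[OF x] by blast
  have "y \<noteq> 0" using y(3) x(2) unfolding sl2_triple_def by auto
  then show ?thesis unfolding is_root_def using y(1) x(3,4) by (metis uminus_apply neg_equal_0_iff_equal)
qed

lemma root_space_cases:
  assumes "x \<in> root_space \<alpha>"
  shows "x = 0 \<or> (\<forall>h\<in>H. \<alpha> h = 0) \<and> x \<in> H \<or> is_root \<alpha>"
proof (cases "\<forall>h\<in>H. \<alpha> h = 0")
  case True
  then have "x \<in> root_space 0" using assms unfolding root_space_def by simp
  then show ?thesis using True root_space_0_eq_H by simp
next
  case False
  then show ?thesis using assms unfolding is_root_def by blast
qed

text \<open>With \<open>t\<close> dual to the sum \<open>\<nu>\<close> under the Killing form, \<open>kappa t t > 0\<close> is a positive combination
  of the values of \<open>\<nu>\<close> on the coroots of the summands.\<close>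

lemma positive_summand:
  assumes roots: "\<And>\<beta>. \<beta> \<in> set \<beta>s \<Longrightarrow> is_root \<beta>" and h0: "h0 \<in> H" "sum_list \<beta>s h0 \<noteq> 0"
  obtains \<beta> e f h k and r :: real
    where "\<beta> \<in> set \<beta>s" "root_triple \<beta> e f h k" "sum_list \<beta>s h = of_real r" "r > 0"
proof -
  let ?n = "length \<beta>s"
  have "\<forall>i\<in>{..<?n}. \<exists>p. case p of (e, f, h, k) \<Rightarrow> root_triple (\<beta>s ! i) e f h k"
    using exists_root_triple roots by simp
  from bchoice[OF this] obtain p where
    p: "\<forall>i\<in>{..<?n}. case p i of (e, f, h, k) \<Rightarrow> root_triple (\<beta>s ! i) e f h k" by blast
  define e f h k where "e i = fst (p i)" and "f i = fst (snd (p i))"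
    and "h i = fst (snd (snd (p i)))" and "k i = snd (snd (snd (p i)))" for i
  have rt: "root_triple (\<beta>s ! i) (e i) (f i) (h i) (k i)" if "i < ?n" for i
    using p that by (auto simp: e_def f_def h_def k_def split: prod.splits)
  have hH: "h i \<in> H" and kpos: "k i > 0" and kh: "\<And>h'. h' \<in> H \<Longrightarrow> kappa (h i) h' = of_real (k i) * (\<beta>s ! i) h'"
    and re: "\<And>\<gamma> z. z \<in> root_space \<gamma> \<Longrightarrow> z \<noteq> 0 \<Longrightarrow> \<exists>r::real. \<gamma> (h i) = of_real r" if "i < ?n" for i
    using rt[OF that] unfolding root_triple_def by blast+
  define \<nu> where "\<nu> = sum_list \<beta>s"
  have ev: "\<nu> x = (\<Sum>i<?n. (\<beta>s ! i) x)" for x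
  proof -
    have "(\<Sum>i<m. g i) x = (\<Sum>i<m. g i x)" for g :: "nat \<Rightarrow> 'a \<Rightarrow> complex" and m :: nat
      by (induction m) simp_all
    then show ?thesis unfolding \<nu>_def sum_list_sum_nth atLeast0LessThan by simp
  qed
  \<comment> \<open>Dividing the coroot \<open>h i\<close> by \<open>k i\<close> gives the Killing
    dual of \<open>\<beta>s ! i\<close>. The weights are real and positive, so \<open>ad t\<close>
    has real eigenvalues and signs survive.\<close>
  define t where "t = (\<Sum>i<?n. of_real (1 / k i) *s h i)"
  have t: "t \<in> H" unfolding t_def using hH by (intro subspace_sum[OF subspace_H] subspace_scale[OF subspace_H]) simp
  have kt: "kappa t h' = \<nu> h'" if h': "h' \<in> H" for h'
  proof -
    have "kappa t h' = (\<Sum>i<?n. of_real (1 / k i) * kappa (h i) h')"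
      unfolding t_def by (simp add: kappa_sum_left kappa_scale_left)
    also have "\<dots> = (\<Sum>i<?n. (\<beta>s ! i) h')"
    proof (rule sum.cong[OF refl])
      fix i assume "i \<in> {..<?n}"
      then have i: "i < ?n" by simp
      show "of_real (1 / k i) * kappa (h i) h' = (\<beta>s ! i) h'"
        unfolding kh[OF i h'] using kpos[OF i] by simp
    qed
    finally show ?thesis unfolding ev .
  qed
  have "t \<noteq> 0" using kt[OF h0(1)] h0(2) unfolding \<nu>_def by auto
  moreover have "\<exists>r::real. \<gamma> t = of_real r" if z: "z \<in> root_space \<gamma>" "z \<noteq> 0" for \<gamma> z
  proof -
    have "\<forall>i\<in>{..<?n}. \<exists>r::real. \<gamma> (h i) = of_real r" using re[OF _ z] by simp
    from bchoice[OF this] obtain r :: "nat \<Rightarrow> real" where r: "\<forall>i\<in>{..<?n}. \<gamma> (h i) = of_real (r i)" by blast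
    have "br t z = (\<Sum>i<?n. of_real (1 / k i) *s br (h i) z)"
      unfolding t_def lin_sum[OF lin_br_left] by (simp only: br_scale_left)
    also have "\<dots> = (\<Sum>i<?n. of_real (r i / k i) *s z)"
    proof (rule sum.cong[OF refl])
      fix i assume i: "i \<in> {..<?n}"
      then have "br (h i) z = of_real (r i) *s z" using root_spaceD[OF z(1)] hH r by simp
      then show "of_real (1 / k i) *s br (h i) z = of_real (r i / k i) *s z" by simp
    qed
    also have "\<dots> = of_real (\<Sum>i<?n. r i / k i) *s z" by (simp add: scale_sum_left)
    finally have "\<gamma> t *s z = of_real (\<Sum>i<?n. r i / k i) *s z" using root_spaceD[OF z(1) t] by simp
    then show ?thesis using z(2) by (metis scale_right_imp_eq)
  qed
  ultimately obtain q :: real where q: "q > 0" "kappa t t = of_real q"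
    using kappa_self_real[OF t] by blast
  have "\<forall>i\<in>{..<?n}. \<exists>l::real. \<nu> (h i) = of_real l"
  proof
    fix i assume "i \<in> {..<?n}"
    then have i: "i < ?n" by simp
    have "\<forall>j\<in>{..<?n}. \<exists>r::real. (\<beta>s ! j) (h i) = of_real r"
    proof
      fix j assume "j \<in> {..<?n}"
      then have "is_root (\<beta>s ! j)" using roots by simp
      then show "\<exists>r::real. (\<beta>s ! j) (h i) = of_real r" using re[OF i] unfolding is_root_def by blast
    qed
    from bchoice[OF this] obtain r :: "nat \<Rightarrow> real" where "\<forall>j\<in>{..<?n}. (\<beta>s ! j) (h i) = of_real (r j)" by blast
    then have "\<nu> (h i) = of_real (\<Sum>j<?n. r j)" unfolding ev by simp
    then show "\<exists>l::real. \<nu> (h i) = of_real l" by blast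
  qed
  from bchoice[OF this] obtain l :: "nat \<Rightarrow> real" where l: "\<forall>i\<in>{..<?n}. \<nu> (h i) = of_real (l i)" by blast
  have "kappa t t = (\<Sum>i<?n. of_real (1 / k i) * kappa (h i) t)"
    by (subst (1) t_def) (simp only: kappa_sum_left kappa_scale_left)
  also have "\<dots> = (\<Sum>i<?n. of_real (l i / k i))"
  proof (rule sum.cong[OF refl])
    fix i assume i: "i \<in> {..<?n}"
    have "kappa (h i) t = \<nu> (h i)" using kt[of "h i"] hH i kappa_comm by simp
    then show "of_real (1 / k i) * kappa (h i) t = of_real (l i / k i)" using l i by simp
  qed
  finally have "of_real q = (of_real (\<Sum>i<?n. l i / k i) :: complex)" using q(2) by simp
  then have "q = (\<Sum>i<?n. l i / k i)" by (simp only: of_real_eq_iff)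
  then have "\<exists>i<?n. l i / k i > 0" using q(1) sum_nonpos[of "{..<?n}" "\<lambda>i. l i / k i"] by force
  then obtain i where i: "i < ?n" "l i / k i > 0" by blast
  then have "l i > 0" using kpos[OF i(1)] by (simp add: zero_less_divide_iff)
  then show ?thesis
    using that[of "\<beta>s ! i" "e i" "f i" "h i" "k i" "l i"] rt[OF i(1)] l i(1) unfolding \<nu>_def by simp
qed

end

section \<open>Overshears\<close>

lemma fin_dim_obtain_basis:
  assumes "fin_dim s"
  obtains B where "fd_complex_space s B"
proof -
  interpret vector_space s using assms unfolding fin_dim_def by blast
  obtain C where C: "finite C" "span C = UNIV" using assms unfolding fin_dim_def by blast
  obtain B where B: "B \<subseteq> C" "independent B" "C \<subseteq> span B" using maximal_independent_subset by blast
  have "span C \<subseteq> span B" using B(3) by (intro span_minimal) auto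
  then have "span B = UNIV" using C(2) by auto
  then have "fd_complex_space s B"
    using B C(1) finite_subset by unfold_locales auto
  then show ?thesis by (rule that)
qed

text \<open>\<open>U\<close> is any invariant subspace containing the overshears;
  \<open>gen_submodule\<close> is the intersection of all of these. The bracket relation for
  \<open>sigma\<close> is derived from its values on pure tensors.\<close>

locale overshear_module = cartan_lie +
  V: fd_complex_space sv Bv + T: fd_complex_space st Bt
  for sv :: "complex \<Rightarrow> 'v::ab_group_add \<Rightarrow> 'v" and Bv
    and st :: "complex \<Rightarrow> 't::ab_group_add \<Rightarrow> 't" and Bt +
  fixes rho :: "'a \<Rightarrow> 'v \<Rightarrow> 'v" and tp :: "'v \<Rightarrow> 'a \<Rightarrow> 't" and sigma :: "'a \<Rightarrow> 't \<Rightarrow> 't" and U :: "'t set"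
  assumes mod: "lie_module sg br sv rho"
    and tp_right: "\<And>v. Vector_Spaces.linear sg st (tp v)"
    and tp_left: "\<And>x. Vector_Spaces.linear sv st (\<lambda>v. tp v x)"
    and span_tp: "T.span {tp v x |v x. True} = UNIV"
    and lin_sigma: "\<And>x. T.lin (sigma x)"
    and sigma_tp: "\<And>x v y. sigma x (tp v y) = tp (rho x v) y + tp v (br x y)"
    and subspace_U: "T.subspace U"
    and sigma_U: "\<And>x u. u \<in> U \<Longrightarrow> sigma x u \<in> U"
    and overshear_U: "\<And>v x. rho x (rho x v) = 0 \<Longrightarrow> tp v x \<in> U"
begin

lemma lin_rho: "V.lin (rho x)" and lin_rho_left: "Vector_Spaces.linear sg sv (\<lambda>x. rho x v)"
  and rho_br: "rho (br x y) v = rho x (rho y v) - rho y (rho x v)"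
  using mod unfolding lie_module_def by blast+

lemma rho_add_left: "rho (x + y) v = rho x v + rho y v"
  and rho_scale_left: "rho (c *s x) v = sv c (rho x v)"
  using lin_rho_left[of v] unfolding Vector_Spaces.linear_iff by blast+

lemma rho_minus_left: "rho (- x) v = - rho x v"
  using rho_scale_left[of "- 1" x v] by simp

lemma rho_zero_left [simp]: "rho 0 v = 0"
  using rho_scale_left[of 0 0 v] by simp

lemma tp_add_right: "tp v (x + y) = tp v x + tp v y"
  and tp_scale_right: "tp v (c *s x) = st c (tp v x)"
  using tp_right[of v] unfolding Vector_Spaces.linear_iff by blast+

lemma tp_add_left: "tp (v + w) x = tp v x + tp w x"
  and tp_scale_left: "tp (sv c v) x = st c (tp v x)"
  using tp_left[of x] unfolding Vector_Spaces.linear_iff by blast+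

lemma tp_zero_right [simp]: "tp v 0 = 0" and tp_zero_left [simp]: "tp 0 x = 0"
  using tp_scale_right[of v 0 0] tp_scale_left[of 0 0 x] by simp_all

lemma tp_minus_right: "tp v (- x) = - tp v x"
  using tp_scale_right[of v "- 1" x] by simp

lemma tp_diff_right: "tp v (x - y) = tp v x - tp v y"
  using tp_add_right[of v "x - y" y] by simp

lemma tp_diff_left: "tp (v - w) x = tp v x - tp w x"
  using tp_add_left[of "v - w" w x] by simp

text \<open>The scalar \<open>c\<close> lets the relations of a triple be read off directly, without
  linearity of \<open>sigma\<close> in its Lie algebra argument.\<close>

lemma sigma_commutator:
  assumes "br x y = c *s z"
  shows "sigma x (sigma y t) = sigma y (sigma x t) + st c (sigma z t)"
proof -
  have "sigma x (sigma y t) - sigma y (sigma x t) = st c (sigma z t)"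
  proof (rule T.lin_eq_on_span[where S = "{tp v x |v x. True}"
        and f = "\<lambda>t. sigma x (sigma y t) - sigma y (sigma x t)" and g = "\<lambda>t. st c (sigma z t)"])
    show "T.lin (\<lambda>t. sigma x (sigma y t) - sigma y (sigma x t))"
      by (rule T.lin_minus[OF T.lin_comp[OF lin_sigma lin_sigma] T.lin_comp[OF lin_sigma lin_sigma]])
    show "T.lin (\<lambda>t. st c (sigma z t))" by (rule T.lin_smult[OF lin_sigma])
    show "t \<in> T.span {tp v x |v x. True}" unfolding span_tp by simp
    fix t assume "t \<in> {tp v x |v x. True}"
    then obtain v w where t: "t = tp v w" by blast
    have "sigma x (sigma y t) - sigma y (sigma x t) = tp (rho (br x y) v) w + tp v (br (br x y) w)"
      unfolding t by (simp add: sigma_tp T.lin_add[OF lin_sigma] rho_br ad_br tp_diff_left tp_diff_right)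
    also have "\<dots> = st c (sigma z t)"
      unfolding assms t by (simp add: sigma_tp rho_scale_left br_scale_left tp_scale_left tp_scale_right
          T.scale_right_distrib)
    finally show "sigma x (sigma y t) - sigma y (sigma x t) = st c (sigma z t)" .
  qed
  then show ?thesis by (simp add: algebra_simps)
qed

lemma sl2_rep_rho:
  assumes "sl2_triple e f h"
  shows "sl2_rep sv Bv (rho e) (rho f) (rho h)"
proof (intro sl2_rep.intro sl2_rep_axioms.intro V.fd_complex_space_axioms)
  show "V.lin (rho e)" "V.lin (rho f)" "V.lin (rho h)" by (rule lin_rho)+
  show "rho h (rho e v) = rho e (rho h v) + sv 2 (rho e v)" for v
    using assms rho_br[of h e v] by (simp add: sl2_triple_def rho_scale_left)
  show "rho h (rho f v) = rho f (rho h v) - sv 2 (rho f v)" for v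
    using assms rho_br[of h f v] by (simp add: sl2_triple_def rho_scale_left rho_minus_left algebra_simps)
  show "rho e (rho f v) = rho f (rho e v) + rho h v" for v
    using assms rho_br[of e f v] by (simp add: sl2_triple_def)
qed

lemma sl2_rep_sigma:
  assumes "sl2_triple e f h"
  shows "sl2_rep st Bt (sigma e) (sigma f) (sigma h)"
proof (intro sl2_rep.intro sl2_rep_axioms.intro T.fd_complex_space_axioms)
  show "T.lin (sigma e)" "T.lin (sigma f)" "T.lin (sigma h)" by (rule lin_sigma)+
  show "sigma h (sigma e v) = sigma e (sigma h v) + st 2 (sigma e v)" for v
    using assms by (intro sigma_commutator) (simp add: sl2_triple_def)
  show "sigma h (sigma f v) = sigma f (sigma h v) - st 2 (sigma f v)" for v
    using assms sigma_commutator[of h f "- 2" f v] by (simp add: sl2_triple_def)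
  show "sigma e (sigma f v) = sigma f (sigma e v) + sigma h v" for v
    using assms sigma_commutator[of e f 1 h v] by (simp add: sl2_triple_def)
qed

text \<open>Applying \<open>f\<close> to the overshear \<open>tp u e\<close> and comparing with the
  overshear \<open>tp (rho f u) e\<close> gives \<open>tp u h\<close>. Further applications of
  \<open>f\<close> give sums of a tensor with \<open>h\<close> and one with \<open>f\<close>; when
  the first vector reaches weight zero, its tensor with \<open>h\<close> is an overshear and can be
  removed.\<close>

lemma highest_weight_tensor_in_U:
  assumes tri: "sl2_triple e f h" and u: "rho e u = 0" "rho h u = sv (2 * of_nat (Suc n)) u"
  shows "tp ((rho f ^^ n) u) f \<in> U"
proof -
  interpret R: sl2_rep sv Bv "rho e" "rho f" "rho h" by (rule sl2_rep_rho[OF tri])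
  define w where "w k = (rho f ^^ k) u" for k
  have fw: "rho f (w k) = w (Suc k)" for k by (simp add: w_def)
  have fe: "br f e = - h" and fh: "br f h = 2 *s f"
    using tri br_anticomm[of f e] br_anticomm[of f h] by (simp_all add: sl2_triple_def)
  have x0: "tp (w 0) e \<in> U"
    by (rule overshear_U) (simp add: w_def u(1) V.lin_zero[OF lin_rho])
  have x1: "tp (w 1) e \<in> U"
  proof (rule overshear_U)
    have "rho e (w 1) = sv (2 * of_nat (Suc n)) u"
      using R.E_F_pow[OF u, of 0] by (simp add: w_def)
    then show "rho e (rho e (w 1)) = 0" by (simp add: V.lin_scale[OF lin_rho] u(1))
  qed
  have "sigma f (tp (w 0) e) = tp (w 1) e - tp (w 0) h"
    by (simp add: sigma_tp fw fe tp_minus_right)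
  then have "tp (w 0) h = tp (w 1) e - sigma f (tp (w 0) e)" by simp
  then have y0: "tp (w 0) h \<in> U"
    using T.subspace_diff[OF subspace_U x1 sigma_U[OF x0]] by simp
  \<comment> \<open>Each application of \<open>f\<close> turns \<open>h\<close> into
    \<open>2 *s f\<close> once and kills \<open>f\<close>, so the coefficient grows by 2.\<close>
  have y: "tp (w (Suc k)) h + st (2 * of_nat (Suc k)) (tp (w k) f) \<in> U" for k
  proof (induction k)
    case 0
    have "sigma f (tp (w 0) h) = tp (w 1) h + st 2 (tp (w 0) f)"
      by (simp add: sigma_tp fw fh tp_scale_right)
    then show ?case using sigma_U[OF y0, of f] by simp
  next
    case (Suc k)
    let ?c = "2 * of_nat (Suc k) :: complex"
    have "sigma f (tp (w (Suc k)) h + st ?c (tp (w k) f))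
        = tp (w (Suc (Suc k))) h + st 2 (tp (w (Suc k)) f) + st ?c (tp (w (Suc k)) f)"
      by (simp only: T.lin_add[OF lin_sigma] T.lin_scale[OF lin_sigma] sigma_tp fw fh br_self
          tp_scale_right tp_zero_right add_0_right)
    also have "\<dots> = tp (w (Suc (Suc k))) h + st (2 + ?c) (tp (w (Suc k)) f)"
      by (simp only: T.scale_left_distrib add.assoc)
    also have "2 + ?c = 2 * of_nat (Suc (Suc k))" by simp
    finally show ?case using sigma_U[OF Suc, of f] by simp
  qed
  \<comment> \<open>The weight \<open>2 * of_nat (Suc n)\<close> of \<open>u\<close> is used up
    after exactly \<open>Suc n\<close> steps, so \<open>h\<close> annihilates this vector.\<close>
  have "tp (w (Suc n)) h \<in> U"
    by (rule overshear_U)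
       (simp add: w_def R.weight_F_pow[OF u(2)] V.lin_zero[OF lin_rho] del: funpow.simps of_nat_Suc)
  then have "st (2 * of_nat (Suc n)) (tp (w n) f) \<in> U"
    using T.subspace_diff[OF subspace_U y[of n]] by fastforce
  from T.subspace_scale[OF subspace_U this, of "inverse (2 * of_nat (Suc n))"]
  have "tp (w n) f \<in> U" by (simp del: of_nat_Suc)
  then show ?thesis unfolding w_def .
qed

text \<open>Instead of decomposing the module, the induction on the power of \<open>e\<close>
  killing \<open>v\<close> peels off one highest weight string at a time: a multiple of
  \<open>f^n u\<close>, where \<open>u = e^n v\<close> is a highest weight vector of weight
  \<open>2 * (n + 1)\<close>, has the same image under \<open>e^n\<close> as
  \<open>v\<close>.\<close>

lemma weight_two_tensor_in_U:
  assumes tri: "sl2_triple e f h" and v: "rho h v = sv 2 v"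
  shows "tp v f \<in> U"
proof -
  interpret R: sl2_rep sv Bv "rho e" "rho f" "rho h" by (rule sl2_rep_rho[OF tri])
  have "(rho e ^^ n) v = 0 \<Longrightarrow> rho h v = sv 2 v \<Longrightarrow> tp v f \<in> U" for n v
  proof (induction n arbitrary: v)
    case 0
    then show ?case using T.subspace_0[OF subspace_U] by simp
  next
    case (Suc n)
    define u where "u = (rho e ^^ n) v"
    have u: "rho e u = 0" "rho h u = sv (2 * of_nat (Suc n)) u"
      using Suc.prems(1) R.weight_E_pow[OF Suc.prems(2), of n] unfolding u_def by simp_all
    have "2 * of_nat (Suc n) \<noteq> (of_nat i :: complex)" if "i < n" for i
    proof -
      have "2 * Suc n \<noteq> i" using that by simp
      then show ?thesis by (metis of_nat_eq_iff of_nat_mult of_nat_numeral)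
    qed
    then obtain c where c: "c \<noteq> 0" "(rho e ^^ n) ((rho f ^^ n) u) = sv c u"
      using R.E_pow_F_pow[OF u, of n] by blast
    let ?w = "sv (1 / c) ((rho f ^^ n) u)"
    have hw: "rho h ?w = sv 2 ?w"
      by (simp add: V.lin_scale[OF lin_rho] R.weight_F_pow[OF u(2)] algebra_simps)
    have "(rho e ^^ n) (v - ?w) = u - sv (1 / c) (sv c u)"
      by (simp add: V.lin_diff[OF V.lin_funpow[OF lin_rho]] V.lin_scale[OF V.lin_funpow[OF lin_rho]]
          u_def[symmetric] c(2))
    then have "(rho e ^^ n) (v - ?w) = 0" using c(1) by simp
    moreover have "rho h (v - ?w) = sv 2 (v - ?w)"
      by (simp only: V.lin_diff[OF lin_rho] hw Suc.prems(2) V.scale_right_diff_distrib)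
    ultimately have "tp (v - ?w) f \<in> U" by (rule Suc.IH)
    moreover have "tp ?w f \<in> U"
      unfolding tp_scale_left
      by (rule T.subspace_scale[OF subspace_U highest_weight_tensor_in_U[OF tri u]])
    ultimately have "tp (v - ?w) f + tp ?w f \<in> U" by (rule T.subspace_add[OF subspace_U])
    then show ?case by (simp add: tp_diff_left)
  qed
  moreover obtain n where "(rho e ^^ n) v = 0"
    using R.loc_nilpotent_E unfolding V.loc_nilpotent_def by blast
  ultimately show ?thesis using v by blast
qed

section \<open>Weight spaces of the module and of its tensor product with the algebra\<close>

definition weight_space :: "('a \<Rightarrow> complex) \<Rightarrow> 'v set" where
  "weight_space \<nu> = {v. \<forall>h\<in>H. rho h v = sv (\<nu> h) v}"

lemma weight_spaceD: "v \<in> weight_space \<nu> \<Longrightarrow> h \<in> H \<Longrightarrow> rho h v = sv (\<nu> h) v"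
  unfolding weight_space_def by blast

lemma rho_weight_space:
  assumes "x \<in> root_space \<alpha>" "v \<in> weight_space \<nu>"
  shows "rho x v \<in> weight_space (\<nu> + \<alpha>)"
  unfolding weight_space_def
proof (intro CollectI ballI)
  fix h assume h: "h \<in> H"
  have "rho h (rho x v) = rho (br h x) v + rho x (rho h v)" by (simp add: rho_br)
  also have "\<dots> = sv ((\<nu> + \<alpha>) h) (rho x v)"
    unfolding root_spaceD[OF assms(1) h] weight_spaceD[OF assms(2) h]
    by (simp add: rho_scale_left V.lin_scale[OF lin_rho] V.scale_left_distrib add.commute)
  finally show "rho h (rho x v) = sv ((\<nu> + \<alpha>) h) (rho x v)" .
qed

text \<open>A span of pure tensors rather than a simultaneous eigenspace of \<open>sigma\<close>, so
  that inclusions need to be tested on generators only.\<close>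

definition tensor_weight_space :: "('a \<Rightarrow> complex) \<Rightarrow> 't set" where
  "tensor_weight_space \<nu>
    = T.span {tp v x |v x. \<exists>\<alpha>. v \<in> weight_space (\<nu> - \<alpha>) \<and> x \<in> root_space \<alpha>}"

lemma tensor_weight_space_zero:
  assumes \<nu>: "\<And>h. h \<in> H \<Longrightarrow> \<nu> h = 0"
  shows "tensor_weight_space \<nu> \<subseteq> U"
  unfolding tensor_weight_space_def
proof (rule T.span_minimal[OF _ subspace_U], safe)
  fix v x \<alpha> assume v: "v \<in> weight_space (\<nu> - \<alpha>)" and x: "x \<in> root_space \<alpha>"
  consider "x = 0" | "\<forall>h\<in>H. \<alpha> h = 0" "x \<in> H" | "x \<noteq> 0" "is_root \<alpha>"
    using root_space_cases[OF x] by blast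
  then show "tp v x \<in> U"
  proof cases
    case 1
    then show ?thesis using T.subspace_0[OF subspace_U] by simp
  next
    case 2
    then have "rho x v = 0" using weight_spaceD[OF v] \<nu> by simp
    then show ?thesis using overshear_U V.lin_zero[OF lin_rho] by simp
  next
    case 3
    then obtain h0 where "h0 \<in> H" "\<alpha> h0 \<noteq> 0" unfolding is_root_def by blast
    then obtain y h where h: "h \<in> H" "sl2_triple x y h"
      using exists_sl2_triple[OF x 3(1)] by blast
    \<comment> \<open>\<open>v\<close> has the weight opposite to \<open>\<alpha>\<close> on
      \<open>H\<close>. In the swapped triple \<open>x\<close> takes the place of \<open>f\<close>
      and \<open>- h\<close> that of \<open>h\<close>, so \<open>v\<close> has weight 2
      there.\<close>
    have "\<alpha> (- h) *s x = (- 2) *s x"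
      using root_spaceD[OF x subspace_neg[OF subspace_H h(1)]] h(2)
      by (simp add: br_minus_left sl2_triple_def)
    then have a: "\<alpha> (- h) = - 2" using 3(1) by (simp del: scale_minus_left)
    have "rho (- h) v = sv 2 v"
      using weight_spaceD[OF v subspace_neg[OF subspace_H h(1)]] \<nu>[OF subspace_neg[OF subspace_H h(1)]]
      by (simp add: a)
    then show ?thesis by (rule weight_two_tensor_in_U[OF sl2_triple_swap[OF h(2)]])
  qed
qed

lemma sigma_tensor_weight_space:
  assumes x: "x \<in> root_space \<beta>" and t: "t \<in> tensor_weight_space \<nu>"
  shows "sigma x t \<in> tensor_weight_space (\<nu> + \<beta>)"
proof -
  let ?S = "{tp v x |v x. \<exists>\<alpha>. v \<in> weight_space (\<nu> - \<alpha>) \<and> x \<in> root_space \<alpha>}"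
  have sub: "T.subspace (tensor_weight_space (\<nu> + \<beta>))" unfolding tensor_weight_space_def by simp
  have "T.subspace {t. sigma x t \<in> tensor_weight_space (\<nu> + \<beta>)}"
    using T.subspace_0[OF sub] T.subspace_add[OF sub] T.subspace_scale[OF sub]
    by (simp add: T.subspace_def T.lin_add[OF lin_sigma] T.lin_scale[OF lin_sigma] T.lin_zero[OF lin_sigma])
  moreover have "?S \<subseteq> {t. sigma x t \<in> tensor_weight_space (\<nu> + \<beta>)}"
  proof safe
    fix v y \<alpha> assume v: "v \<in> weight_space (\<nu> - \<alpha>)" and y: "y \<in> root_space \<alpha>"
    have "rho x v \<in> weight_space (\<nu> + \<beta> - \<alpha>)"
      using rho_weight_space[OF x v] by (simp add: algebra_simps)
    then have 1: "tp (rho x v) y \<in> tensor_weight_space (\<nu> + \<beta>)"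
      unfolding tensor_weight_space_def using y by (intro T.span_base) blast
    have "v \<in> weight_space (\<nu> + \<beta> - (\<beta> + \<alpha>))" using v by (simp add: algebra_simps)
    then have 2: "tp v (br x y) \<in> tensor_weight_space (\<nu> + \<beta>)"
      unfolding tensor_weight_space_def using br_root_space[OF x y] by (intro T.span_base) blast
    show "sigma x (tp v y) \<in> tensor_weight_space (\<nu> + \<beta>)"
      unfolding sigma_tp by (rule T.subspace_add[OF sub 1 2])
  qed
  ultimately have "T.span ?S \<subseteq> {t. sigma x t \<in> tensor_weight_space (\<nu> + \<beta>)}"
    by (rule T.span_minimal[rotated])
  then show ?thesis using t unfolding tensor_weight_space_def by blast
qed

lemma sigma_H_tensor_weight_space:
  assumes h: "h \<in> H" and t: "t \<in> tensor_weight_space \<nu>"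
  shows "sigma h t = st (\<nu> h) t"
proof (rule T.lin_eq_on_span[OF lin_sigma T.lin_scale_self _ t[unfolded tensor_weight_space_def]], safe)
  fix v x \<alpha> assume v: "v \<in> weight_space (\<nu> - \<alpha>)" and x: "x \<in> root_space \<alpha>"
  show "sigma h (tp v x) = st (\<nu> h) (tp v x)"
    unfolding sigma_tp weight_spaceD[OF v h] root_spaceD[OF x h]
    by (simp add: tp_scale_left tp_scale_right T.scale_left_diff_distrib)
qed

text \<open>Stripping off a summand \<open>\<beta>\<close> on whose coroot the weight is positive: modulo \<open>U\<close> the lowering
  operator of \<open>\<beta>\<close> is injective on that weight space.\<close>

lemma tensor_weight_space_in_U:
  assumes "\<And>\<beta>. \<beta> \<in> set \<beta>s \<Longrightarrow> is_root \<beta>"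
  shows "tensor_weight_space (sum_list \<beta>s) \<subseteq> U"
  using assms
proof (induction "length \<beta>s" arbitrary: \<beta>s)
  case 0
  then show ?case by (intro tensor_weight_space_zero) simp
next
  case (Suc n)
  show ?case
  proof (cases "\<exists>h\<in>H. sum_list \<beta>s h \<noteq> 0")
    \<comment> \<open>A nonempty list of roots may sum to zero on \<open>H\<close>. No summand can
      then be stripped off by positivity, but the zero weight case applies directly.\<close>
    case False
    then show ?thesis by (intro tensor_weight_space_zero) blast
  next
    case True
    then obtain h0 where "h0 \<in> H" "sum_list \<beta>s h0 \<noteq> 0" by blast
    then obtain \<beta> e f h k and r :: real where \<beta>: "\<beta> \<in> set \<beta>s" "root_triple \<beta> e f h k"
        "sum_list \<beta>s h = of_real r" "r > 0"
      using positive_summand[of \<beta>s h0] Suc.prems by metis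
    have tri: "f \<in> root_space (- \<beta>)" "h \<in> H" "sl2_triple e f h"
      using \<beta>(2) unfolding root_triple_def by blast+
    let ?\<beta>s = "remove1 \<beta> \<beta>s"
    have sum: "sum_list \<beta>s + - \<beta> = sum_list ?\<beta>s"
      using sum_list_map_remove1[OF \<beta>(1), of "\<lambda>x. x"] by simp
    have "n = length ?\<beta>s" using Suc.hyps(2) \<beta>(1) by (simp add: length_remove1)
    then have IH: "tensor_weight_space (sum_list ?\<beta>s) \<subseteq> U"
      using Suc.prems by (intro Suc.hyps(1)) (auto dest: notin_set_remove1 set_remove1_subset[THEN subsetD])
    interpret S: sl2_rep st Bt "sigma e" "sigma f" "sigma h" by (rule sl2_rep_sigma[OF tri(3)])
    show ?thesis
    proof
      fix t assume t: "t \<in> tensor_weight_space (sum_list \<beta>s)"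
      have ft: "sigma f t \<in> U"
        using sigma_tensor_weight_space[OF tri(1) t] IH unfolding sum by blast
      have ht: "sigma h t = st (of_real r) t"
        using sigma_H_tensor_weight_space[OF tri(2) t] \<beta>(3) by simp
      show "t \<in> U"
        by (rule S.lowering_injective_mod[OF subspace_U sigma_U sigma_U ft ht \<beta>(4)])
    qed
  qed
qed

text \<open>Since roots come with their negatives, sums of lists already cover the root lattice.
  Lists without coefficients suit the induction that removes one summand at a time.\<close>

definition root_sums :: "('a \<Rightarrow> complex) set" where
  "root_sums = {sum_list \<beta>s |\<beta>s. \<forall>\<beta>\<in>set \<beta>s. is_root \<beta>}"

lemma root_sums_zero: "0 \<in> root_sums"
  unfolding root_sums_def by (intro CollectI exI[of _ "[]"]) simp

lemma root_sums_add: "a \<in> root_sums \<Longrightarrow> b \<in> root_sums \<Longrightarrow> a + b \<in> root_sums"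
proof -
  assume "a \<in> root_sums" "b \<in> root_sums"
  then obtain as bs where "a = sum_list as" "\<forall>\<beta>\<in>set as. is_root \<beta>" "b = sum_list bs" "\<forall>\<beta>\<in>set bs. is_root \<beta>"
    unfolding root_sums_def by blast
  then show ?thesis unfolding root_sums_def by (intro CollectI exI[of _ "as @ bs"]) auto
qed

lemma root_sums_root: "is_root \<alpha> \<Longrightarrow> \<alpha> \<in> root_sums"
  unfolding root_sums_def by (intro CollectI exI[of _ "[\<alpha>]"]) simp

lemma root_sums_sum: "(\<And>i. i \<in> I \<Longrightarrow> g i \<in> root_sums) \<Longrightarrow> sum g I \<in> root_sums"
  by (induction I rule: infinite_finite_induct) (simp_all add: root_sums_zero root_sums_add)

lemma root_sums_of_int:
  assumes \<alpha>: "is_root \<alpha>"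
  shows "(\<lambda>x. of_int c * \<alpha> x) \<in> root_sums"
proof -
  have nat: "(\<lambda>x. of_nat n * \<beta> x) \<in> root_sums" if \<beta>: "is_root \<beta>" for n \<beta>
  proof (induction n)
    case 0
    have "(\<lambda>x. of_nat 0 * \<beta> x) = 0" by (simp add: fun_eq_iff)
    then show ?case using root_sums_zero by simp
  next
    case (Suc n)
    have "(\<lambda>x. of_nat (Suc n) * \<beta> x) = (\<lambda>x. of_nat n * \<beta> x) + \<beta>"
      by (simp add: fun_eq_iff algebra_simps)
    then show ?case using root_sums_add[OF Suc root_sums_root[OF \<beta>]] by simp
  qed
  show ?thesis
  proof (cases c)
    case (nonneg n)
    then show ?thesis using nat[OF \<alpha>, of n] by simp
  next
    case (neg n)
    have "(\<lambda>x. of_int c * \<alpha> x) = (\<lambda>x. of_nat (Suc n) * (- \<alpha>) x)"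
      by (simp add: neg fun_eq_iff algebra_simps)
    then show ?thesis using nat[OF is_root_uminus[OF \<alpha>], of "Suc n"] by simp
  qed
qed

lemma is_root_if_roots: "\<alpha> \<in> roots sg br H \<Longrightarrow> is_root \<alpha>"
  unfolding roots_def is_root_def root_space_def by blast

lemma root_lattice_subset_root_sums:
  assumes "\<nu> \<in> root_lattice sg br H"
  shows "\<nu> \<in> root_sums"
proof -
  obtain c :: "('a \<Rightarrow> complex) \<Rightarrow> int" where
    "\<nu> = (\<lambda>x. \<Sum>\<alpha>\<in>roots sg br H. of_int (c \<alpha>) * \<alpha> x)"
    using assms unfolding root_lattice_def by blast
  moreover have "(\<Sum>\<alpha>\<in>I. g \<alpha>) = (\<lambda>x. \<Sum>\<alpha>\<in>I. g \<alpha> x)"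
    for g :: "('a \<Rightarrow> complex) \<Rightarrow> 'a \<Rightarrow> complex" and I
    by (induction I rule: infinite_finite_induct) (simp_all add: fun_eq_iff)
  ultimately have "\<nu> = (\<Sum>\<alpha>\<in>roots sg br H. (\<lambda>x. of_int (c \<alpha>) * \<alpha> x))" by simp
  then show ?thesis
    using root_sums_sum[of "roots sg br H" "\<lambda>\<alpha> x. of_int (c \<alpha>) * \<alpha> x"]
      root_sums_of_int is_root_if_roots by simp
qed

text \<open>Root vectors shift weights by roots and \<open>H\<close> acts by scalars, so this span
  is a submodule. It contains \<open>v\<close>, and irreducibility yields both the weight
  decomposition and the fact that all weights involved are sums of roots.\<close>

lemma span_weight_spaces:
  assumes irr: "irreducible_module sv rho"
    and \<mu>: "\<mu> \<in> root_sums" and v: "v \<in> weight_space \<mu>" "v \<noteq> 0"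
  shows "V.span (\<Union>\<nu>\<in>root_sums. weight_space \<nu>) = UNIV"
proof -
  let ?S = "\<Union>\<nu>\<in>root_sums. weight_space \<nu>"
  have 1: "rho x w \<in> V.span ?S" if x: "x \<in> (\<Union>\<alpha>. root_space \<alpha>)" and w: "w \<in> ?S" for x w
  proof -
    obtain \<alpha> where \<alpha>: "x \<in> root_space \<alpha>" using x by blast
    obtain \<nu> where \<nu>: "\<nu> \<in> root_sums" "w \<in> weight_space \<nu>" using w by blast
    consider "x = 0" | "x \<in> H" | "is_root \<alpha>" using root_space_cases[OF \<alpha>] by blast
    then show ?thesis
    proof cases
      case 1
      then show ?thesis using V.span_zero by simp
    next
      case 2
      then show ?thesis
        using weight_spaceD[OF \<nu>(2)] V.span_scale[OF V.span_base[OF w]] by simp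
    next
      case 3
      have "rho x w \<in> weight_space (\<nu> + \<alpha>)" by (rule rho_weight_space[OF \<alpha> \<nu>(2)])
      moreover have "\<nu> + \<alpha> \<in> root_sums" by (rule root_sums_add[OF \<nu>(1) root_sums_root[OF 3]])
      ultimately show ?thesis by (intro V.span_base) blast
    qed
  qed
  have 2: "rho x w \<in> V.span ?S" if w: "w \<in> ?S" for x w
  proof -
    have "subspace {x. rho x w \<in> V.span ?S}"
      using V.span_zero V.span_add V.span_scale
      by (simp add: subspace_def rho_add_left rho_scale_left)
    then have "span (\<Union>\<alpha>. root_space \<alpha>) \<subseteq> {x. rho x w \<in> V.span ?S}"
      using 1[OF _ w] by (intro span_minimal) auto
    then show ?thesis unfolding span_root_spaces by blast
  qed
  have 3: "rho x w \<in> V.span ?S" if w: "w \<in> V.span ?S" for x w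
  proof -
    have "V.subspace {w. rho x w \<in> V.span ?S}"
      using V.span_zero V.span_add V.span_scale
      by (simp add: V.subspace_def V.lin_add[OF lin_rho] V.lin_scale[OF lin_rho] V.lin_zero[OF lin_rho])
    then have "V.span ?S \<subseteq> {w. rho x w \<in> V.span ?S}"
      using 2 by (intro V.span_minimal) auto
    then show ?thesis using w by blast
  qed
  have "invariant_subspace sv rho (V.span ?S)"
    unfolding invariant_subspace_def using 3 by simp
  then have "V.span ?S = {0} \<or> V.span ?S = UNIV"
    using irr unfolding irreducible_module_def by blast
  moreover have "v \<in> V.span ?S" using \<mu> v(1) by (intro V.span_base) blast
  ultimately show ?thesis using v(2) by blast
qed

lemma U_UNIV:
  assumes "irreducible_module sv rho" "\<mu> \<in> root_lattice sg br H" "\<mu> \<in> weights H sv rho"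
  shows "U = UNIV"
proof -
  let ?S = "\<Union>\<nu>\<in>root_sums. weight_space \<nu>"
  obtain v0 where v0: "v0 \<noteq> 0" "v0 \<in> weight_space \<mu>"
    using assms(3) unfolding weights_def weight_space_def by blast
  have spanS: "V.span ?S = UNIV"
    by (rule span_weight_spaces[OF assms(1) root_lattice_subset_root_sums[OF assms(2)] v0(2,1)])
  have sumU: "tensor_weight_space \<nu> \<subseteq> U" if "\<nu> \<in> root_sums" for \<nu>
    using that tensor_weight_space_in_U unfolding root_sums_def by blast
  have 1: "tp v x \<in> U" if v: "v \<in> ?S" and x: "x \<in> (\<Union>\<alpha>. root_space \<alpha>)" for v x
  proof -
    obtain \<alpha> where \<alpha>: "x \<in> root_space \<alpha>" using x by blast
    obtain \<nu> where \<nu>: "\<nu> \<in> root_sums" "v \<in> weight_space \<nu>" using v by blast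
    \<comment> \<open>The index is kept free because for \<open>x\<close> in \<open>H\<close> the
      given \<open>\<alpha>\<close> may be nonzero off \<open>H\<close>, so that
      \<open>\<nu> + \<alpha>\<close> need not be a sum of roots; the index \<open>0\<close> is used
      in that case.\<close>
    have mem: "tp v x \<in> tensor_weight_space (\<nu> + \<gamma>)" if "x \<in> root_space \<gamma>" for \<gamma>
      unfolding tensor_weight_space_def using \<nu>(2) that
      by (intro T.span_base CollectI exI[of _ v] exI[of _ x] exI[of _ \<gamma>] conjI refl) simp_all
    consider "x = 0" | "x \<in> H" | "is_root \<alpha>" using root_space_cases[OF \<alpha>] by blast
    then show ?thesis
    proof cases
      case 1
      then show ?thesis using T.subspace_0[OF subspace_U] by simp
    next
      case 2
      then show ?thesis using mem[OF H_subset_root_space_0] sumU[OF \<nu>(1)] by auto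
    next
      case 3
      then show ?thesis using mem[OF \<alpha>] sumU[OF root_sums_add[OF \<nu>(1) root_sums_root[OF 3]]] by blast
    qed
  qed
  have 2: "tp v x \<in> U" if v: "v \<in> ?S" for v x
  proof -
    have "subspace {x. tp v x \<in> U}"
      using T.subspace_0[OF subspace_U] T.subspace_add[OF subspace_U] T.subspace_scale[OF subspace_U]
      by (simp add: subspace_def tp_add_right tp_scale_right)
    then have "span (\<Union>\<alpha>. root_space \<alpha>) \<subseteq> {x. tp v x \<in> U}"
      using 1[OF v] by (intro span_minimal) auto
    then show ?thesis unfolding span_root_spaces by blast
  qed
  have 3: "tp v x \<in> U" for v x
  proof -
    have "V.subspace {v. tp v x \<in> U}"
      using T.subspace_0[OF subspace_U] T.subspace_add[OF subspace_U] T.subspace_scale[OF subspace_U]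
      by (simp add: V.subspace_def tp_add_left tp_scale_left)
    then have "V.span ?S \<subseteq> {v. tp v x \<in> U}"
      using 2 by (intro V.span_minimal) auto
    then show ?thesis unfolding spanS by blast
  qed
  have "T.span {tp v x |v x. True} \<subseteq> U" using 3 by (intro T.span_minimal subspace_U) auto
  then show ?thesis unfolding span_tp by blast
qed

end

lemma fin_dim_tensor_product:
  assumes "fin_dim sv" "fin_dim sg" "tensor_product sv sg st tp"
  shows "fin_dim st"
proof -
  interpret V: vector_space sv using assms(1) unfolding fin_dim_def by blast
  interpret G: vector_space sg using assms(2) unfolding fin_dim_def by blast
  interpret T: vector_space st using assms(3) unfolding tensor_product_def by blast
  obtain A where A: "finite A" "V.span A = UNIV" using assms(1) unfolding fin_dim_def by blast
  obtain B where B: "finite B" "G.span B = UNIV" using assms(2) unfolding fin_dim_def by blast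
  have lin: "Vector_Spaces.linear sg st (tp v)" "Vector_Spaces.linear sv st (\<lambda>v. tp v x)" for v x
    using assms(3) unfolding tensor_product_def by blast+
  have span: "T.span {tp v x |v x. True} = UNIV"
    using assms(3) unfolding tensor_product_def by blast
  let ?C = "(\<lambda>(a, b). tp a b) ` (A \<times> B)"
  have 1: "tp a x \<in> T.span ?C" if a: "a \<in> A" for a x
  proof -
    interpret L: Vector_Spaces.linear sg st "tp a" by (rule lin)
    have "G.span B \<subseteq> {x. tp a x \<in> T.span ?C}"
      using a by (intro G.span_minimal L.subspace_linear_preimage) (auto intro!: T.span_base)
    then show ?thesis using B(2) by blast
  qed
  have 2: "tp v x \<in> T.span ?C" for v x
  proof -
    interpret L: Vector_Spaces.linear sv st "\<lambda>v. tp v x" by (rule lin)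
    have "V.span A \<subseteq> {v. tp v x \<in> T.span ?C}"
      using 1 by (intro V.span_minimal L.subspace_linear_preimage) auto
    then show ?thesis using A(2) by blast
  qed
  have "T.span {tp v x |v x. True} \<subseteq> T.span ?C" using 2 by (intro T.span_minimal) auto
  then have "T.span ?C = UNIV" unfolding span by blast
  moreover have "finite ?C" using A(1) B(1) by simp
  ultimately show ?thesis
    unfolding fin_dim_def by (intro conjI exI[of _ ?C] T.vector_space_axioms)
qed

theorem theorem5p2:
  fixes sg :: "complex \<Rightarrow> 'g::ab_group_add \<Rightarrow> 'g"
    and br :: "'g \<Rightarrow> 'g \<Rightarrow> 'g"
    and sv :: "complex \<Rightarrow> 'v::ab_group_add \<Rightarrow> 'v"
    and rho :: "'g \<Rightarrow> 'v \<Rightarrow> 'v"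
    and H :: "'g set"
    and \<Delta> :: "('g \<Rightarrow> complex) set"
    and \<mu> :: "'g \<Rightarrow> complex"
    and st :: "complex \<Rightarrow> 't::ab_group_add \<Rightarrow> 't"
    and tp :: "'v \<Rightarrow> 'g \<Rightarrow> 't"
    and sigma :: "'g \<Rightarrow> 't \<Rightarrow> 't"
  assumes "simple_lie_algebra sg br" and "fin_dim sg"
    and "lie_module sg br sv rho" and "fin_dim sv" and "irreducible_module sv rho"
    and "cartan_subalgebra sg br H" and "root_base sg br H \<Delta>"
    and "highest_weight sg br H \<Delta> sv rho \<mu>"
    and "\<mu> \<in> root_lattice sg br H"
    and "tensor_product sv sg st tp"
    and "\<forall>x. Vector_Spaces.linear st st (sigma x)"
    and "\<forall>x v y. sigma x (tp v y) = tp (rho x v) y + tp v (br x y)"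
  shows "gen_submodule st sigma {tp v x | v x. rho x (rho x v) = 0} = UNIV"
proof -
  obtain Bg where G: "fd_complex_space sg Bg" using fin_dim_obtain_basis[OF assms(2)] by blast
  obtain Bv where V: "fd_complex_space sv Bv" using fin_dim_obtain_basis[OF assms(4)] by blast
  obtain Bt where T: "fd_complex_space st Bt"
    using fin_dim_obtain_basis[OF fin_dim_tensor_product[OF assms(4,2,10)]] by blast
  have \<mu>: "\<mu> \<in> weights H sv rho" using assms(8) unfolding highest_weight_def by blast
  have "U = UNIV"
    if U: "invariant_subspace st sigma U" "{tp v x | v x. rho x (rho x v) = 0} \<subseteq> U" for U
  proof -
    have "cartan_lie sg Bg br H"
      using assms(1,6) G
      by (intro cartan_lie.intro simple_fd_lie.intro fd_lie_algebra.intro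
          cartan_lie_axioms.intro simple_fd_lie_axioms.intro fd_lie_algebra_axioms.intro)
         (auto simp: simple_lie_algebra_def)
    moreover have "overshear_module_axioms sg br sv st rho tp sigma U"
      using assms(3,10,11,12) U
      unfolding overshear_module_axioms_def tensor_product_def invariant_subspace_def by blast
    ultimately interpret overshear_module sg Bg br H sv Bv st Bt rho tp sigma U
      using V T by (intro overshear_module.intro)
    show ?thesis by (rule U_UNIV[OF assms(5,9) \<mu>])
  qed
  then show ?thesis unfolding gen_submodule_def by blast
qed

end
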